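(* Let $\Bbbk$ be a field of characteristic different from $2$, and let $A_{C_2\times C_2}$ be equipped with any of its quasitriangular structures $\mathcal{R}_a$ ($a\in\Bbbk$, $q\in\{0,1\}$) described in the context. Then an element $\chi\in A_{C_2\times C_2}\otimes A_{C_2\times C_2}$ is an infinitesimal $\mathcal{R}$-matrix for $(A_{C_2\times C_2},\mathcal{R}_a)$ if and only if $\chi=\alpha\, x\otimes xg$ for some $\alpha\in\Bbbk$.
   Context: $A_{C_2\times C_2}$ is the $8$-dimensional Hopf algebra generated as an algebra by $g,h,x$ with relations $g^2=h^2=1$, $x^2=0$, $gh=hg$, $gx=-xg$, $hx=-xh$, with basis $\{1,g,h,gh,x,gx,hx,ghx\}$, comultiplication $\Delta(g)=g\otimes g$, $\Delta(h)=h\otimes h$, $\Delta(x)=1\otimes x+x\otimes g$, counit $\varepsilon(g)=\varepsilon(h)=1$, $\varepsilon(x)=0$, antipode $S(g)=g$, $S(h)=h$, $S(x)=-xg$. Its quasitriangular structures form two $1$-parameter families (one for each $q\in\{0,1\}$): $$\mathcal{R}_a=\mathcal{R}_q(1\otimes 1+a\,x\otimes gx),\quad a\in\Bbbk,\ q\in\{0,1\},\qquad \mathcal{R}_q=\tfrac14\sum_{i,j,k,l=0}^{1}(-1)^{-ij-kl}\,g^ih^k\otimes g^{\,j+q(j+l)}h^{\,q(j+l)}.$$ For a bialgebra $H$ and $T=\sum_i T^i\otimes T_i\in H\otimes H$ write $T_{12}=T\otimes 1$, $T_{23}=1\otimes T$, $T_{13}=\sum_i T^i\otimes 1\otimes T_i$.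 A quasitriangular structure on $H$ is an invertible $\mathcal{R}\in H\otimes H$ with $\Delta^{\mathrm{op}}(h)=\mathcal{R}\Delta(h)\mathcal{R}^{-1}$ for all $h$, $(\mathrm{Id}\otimes\Delta)(\mathcal{R})=\mathcal{R}_{13}\mathcal{R}_{12}$, $(\Delta\otimes\mathrm{Id})(\mathcal{R})=\mathcal{R}_{13}\mathcal{R}_{23}$. An infinitesimal $\mathcal{R}$-matrix for $(H,\mathcal{R})$ is $\chi\in H\otimes H$ such that $\chi\Delta(h)=\Delta(h)\chi$ for all $h\in H$, $(\mathrm{Id}\otimes\Delta)(\chi)=\chi_{12}+\mathcal{R}_{12}^{-1}\chi_{13}\mathcal{R}_{12}$, and $(\Delta\otimes\mathrm{Id})(\chi)=\chi_{23}+\mathcal{R}_{23}^{-1}\chi_{13}\mathcal{R}_{23}$. *)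

theory Defs
  imports "HOL-Analysis.Cartesian_Space"
begin

text \<open>
  A finite-dimensional \<open>k\<close>-vector space with a chosen finite basis \<open>'b\<close> is modelled as
  \<^typ>\<open>'k^'b\<close>, with basis vectors \<open>axis b 1\<close>.  The tensor product of
  \<^typ>\<open>'k^'b\<close> and \<^typ>\<open>'k^'c\<close> is \<^typ>\<open>'k^('b \<times> 'c)\<close>.  Beware that the type class
  product \<open>*\<close> on \<^typ>\<open>'k^'b\<close> is the componentwise one and is never used here.
\<close>

section \<open>Linear algebra over a basis\<close>

definition lin_ext :: "('b::finite \<Rightarrow> ('k::field)^('c::finite)) \<Rightarrow> 'k^'b \<Rightarrow> 'k^'c" where
  "lin_ext f u = (\<Sum>b\<in>UNIV. (u $ b) *s f b)"

definition bilin_ext ::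
    "('b::finite \<Rightarrow> 'c::finite \<Rightarrow> ('k::field)^('d::finite)) \<Rightarrow> 'k^'b \<Rightarrow> 'k^'c \<Rightarrow> 'k^'d" where
  "bilin_ext f u v = (\<Sum>b\<in>UNIV. \<Sum>c\<in>UNIV. (u $ b * v $ c) *s f b c)"

definition tensor ::
    "('k::field)^('b::finite) \<Rightarrow> 'k^('c::finite) \<Rightarrow> 'k^('b \<times> 'c)"  (infixr "\<otimes>" 75) where
  "u \<otimes> v = (\<chi> p. u $ fst p * v $ snd p)"

definition flip :: "'k^('b::finite \<times> 'c::finite) \<Rightarrow> 'k^('c \<times> 'b)" where
  "flip t = (\<chi> p. t $ (snd p, fst p))"

text \<open>The canonical identification of \<open>(U \<otimes> V) \<otimes> W\<close> with \<open>U \<otimes> (V \<otimes> W)\<close>.\<close>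

definition assoc_tensor :: "'k^(('b::finite \<times> 'c::finite) \<times> 'd::finite) \<Rightarrow> 'k^('b \<times> 'c \<times> 'd)" where
  "assoc_tensor t = (\<chi> p. t $ ((fst p, fst (snd p)), snd (snd p)))"

definition map_tensor_left ::
    "('b::finite \<Rightarrow> ('k::field)^('c::finite)) \<Rightarrow> 'k^('b \<times> 'd::finite) \<Rightarrow> 'k^('c \<times> 'd)" where
  "map_tensor_left f = lin_ext (\<lambda>(b, d). f b \<otimes> axis d 1)"

definition map_tensor_right ::
    "('b::finite \<Rightarrow> ('k::field)^('c::finite)) \<Rightarrow> 'k^('d::finite \<times> 'b) \<Rightarrow> 'k^('d \<times> 'c)" where
  "map_tensor_right f = lin_ext (\<lambda>(d, b). axis d 1 \<otimes> f b)"


section \<open>Algebras, bialgebras and Hopf algebras\<close>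

text \<open>All structure maps are given by their values on the basis and extended (bi)linearly.\<close>

record ('b::finite, 'k) alg =
  prod_basis :: "'b \<Rightarrow> 'b \<Rightarrow> 'k^'b"
  unit_vec :: "'k^'b"  ("\<one>\<index>")

record ('b::finite, 'k) bialg = "('b::finite, 'k) alg" +
  coprod_basis :: "'b \<Rightarrow> 'k^('b \<times> 'b)"
  counit_basis :: "'b \<Rightarrow> 'k"

record ('b::finite, 'k) hopf = "('b::finite, 'k) bialg" +
  antipode_basis :: "'b \<Rightarrow> 'k^'b"

definition alg_mult ::
    "('b::finite, 'k::field, 'm) alg_scheme \<Rightarrow> 'k^'b \<Rightarrow> 'k^'b \<Rightarrow> 'k^'b"  (infixl "\<cdot>\<index>" 70) where
  "u \<cdot>\<^bsub>H\<^esub> v = bilin_ext (prod_basis H) u v"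

primrec alg_pow ::
    "('b::finite, 'k::field, 'm) alg_scheme \<Rightarrow> 'k^'b \<Rightarrow> nat \<Rightarrow> 'k^'b" where
  "alg_pow H u 0 = \<one>\<^bsub>H\<^esub>"
| "alg_pow H u (Suc n) = u \<cdot>\<^bsub>H\<^esub> alg_pow H u n"

definition is_inverse ::
    "('b::finite, 'k::field, 'm) alg_scheme \<Rightarrow> 'k^'b \<Rightarrow> 'k^'b \<Rightarrow> bool" where
  "is_inverse H u v \<longleftrightarrow> u \<cdot>\<^bsub>H\<^esub> v = \<one>\<^bsub>H\<^esub> \<and> v \<cdot>\<^bsub>H\<^esub> u = \<one>\<^bsub>H\<^esub>"

definition alg_inv ::
    "('b::finite, 'k::field, 'm) alg_scheme \<Rightarrow> 'k^'b \<Rightarrow> 'k^'b" where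
  "alg_inv H u = (THE v. is_inverse H u v)"

definition tensor_alg ::
    "('b::finite, 'k::field, 'm) alg_scheme \<Rightarrow> ('c::finite, 'k, 'n) alg_scheme \<Rightarrow> ('b \<times> 'c, 'k) alg" where
  "tensor_alg H K =
    \<lparr>prod_basis = (\<lambda>(a, b) (c, d). prod_basis H a c \<otimes> prod_basis K b d),
     unit_vec = \<one>\<^bsub>H\<^esub> \<otimes> \<one>\<^bsub>K\<^esub>\<rparr>"

abbreviation alg2 :: "('b::finite, 'k::field, 'm) alg_scheme \<Rightarrow> ('b \<times> 'b, 'k) alg" where
  "alg2 H \<equiv> tensor_alg H H"

abbreviation alg3 :: "('b::finite, 'k::field, 'm) alg_scheme \<Rightarrow> ('b \<times> 'b \<times> 'b, 'k) alg" where
  "alg3 H \<equiv> tensor_alg H (alg2 H)"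

definition coprod ::
    "('b::finite, 'k::field, 'm) bialg_scheme \<Rightarrow> 'k^'b \<Rightarrow> 'k^('b \<times> 'b)" where
  "coprod H = lin_ext (coprod_basis H)"

definition counit ::
    "('b::finite, 'k::field, 'm) bialg_scheme \<Rightarrow> 'k^'b \<Rightarrow> 'k" where
  "counit H u = (\<Sum>b\<in>UNIV. u $ b * counit_basis H b)"

definition antipode ::
    "('b::finite, 'k::field, 'm) hopf_scheme \<Rightarrow> 'k^'b \<Rightarrow> 'k^'b" where
  "antipode H = lin_ext (antipode_basis H)"

definition coprod_op ::
    "('b::finite, 'k::field, 'm) bialg_scheme \<Rightarrow> 'k^'b \<Rightarrow> 'k^('b \<times> 'b)" where
  "coprod_op H u = flip (coprod H u)"

text \<open>\<open>Id \<otimes> \<Delta>\<close> and \<open>\<Delta> \<otimes> Id\<close> as maps from \<open>H \<otimes> H\<close> to \<open>H \<otimes> H \<otimes> H\<close>.\<close>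

definition id_coprod ::
    "('b::finite, 'k::field, 'm) bialg_scheme \<Rightarrow> 'k^('b \<times> 'b) \<Rightarrow> 'k^('b \<times> 'b \<times> 'b)" where
  "id_coprod H t = map_tensor_right (coprod_basis H) t"

definition coprod_id ::
    "('b::finite, 'k::field, 'm) bialg_scheme \<Rightarrow> 'k^('b \<times> 'b) \<Rightarrow> 'k^('b \<times> 'b \<times> 'b)" where
  "coprod_id H t = assoc_tensor (map_tensor_left (coprod_basis H) t)"

definition is_algebra :: "('b::finite, 'k::field, 'm) alg_scheme \<Rightarrow> bool" where
  "is_algebra H \<longleftrightarrow>
    (\<forall>u v w. (u \<cdot>\<^bsub>H\<^esub> v) \<cdot>\<^bsub>H\<^esub> w = u \<cdot>\<^bsub>H\<^esub> (v \<cdot>\<^bsub>H\<^esub> w)) \<and>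
    (\<forall>u. \<one>\<^bsub>H\<^esub> \<cdot>\<^bsub>H\<^esub> u = u \<and> u \<cdot>\<^bsub>H\<^esub> \<one>\<^bsub>H\<^esub> = u)"

definition is_bialgebra :: "('b::finite, 'k::field, 'm) bialg_scheme \<Rightarrow> bool" where
  "is_bialgebra H \<longleftrightarrow> is_algebra H \<and>
    (\<forall>u. id_coprod H (coprod H u) = coprod_id H (coprod H u)) \<and>
    (\<forall>u. lin_ext (\<lambda>(a, b). counit_basis H a *s axis b 1) (coprod H u) = u \<and>
         lin_ext (\<lambda>(a, b). counit_basis H b *s axis a 1) (coprod H u) = u) \<and>
    (\<forall>u v. coprod H (u \<cdot>\<^bsub>H\<^esub> v) = coprod H u \<cdot>\<^bsub>alg2 H\<^esub> coprod H v) \<and>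
    coprod H \<one>\<^bsub>H\<^esub> = \<one>\<^bsub>alg2 H\<^esub> \<and>
    (\<forall>u v. counit H (u \<cdot>\<^bsub>H\<^esub> v) = counit H u * counit H v) \<and>
    counit H \<one>\<^bsub>H\<^esub> = 1"

definition is_hopf_algebra :: "('b::finite, 'k::field, 'm) hopf_scheme \<Rightarrow> bool" where
  "is_hopf_algebra H \<longleftrightarrow> is_bialgebra H \<and>
    (\<forall>u. lin_ext (\<lambda>(a, b). antipode_basis H a \<cdot>\<^bsub>H\<^esub> axis b 1) (coprod H u) = counit H u *s \<one>\<^bsub>H\<^esub> \<and>
         lin_ext (\<lambda>(a, b). axis a 1 \<cdot>\<^bsub>H\<^esub> antipode_basis H b) (coprod H u) = counit H u *s \<one>\<^bsub>H\<^esub>)"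


section \<open>Quasitriangular structures and infinitesimal R-matrices\<close>

definition leg12 ::
    "('b::finite, 'k::field, 'm) alg_scheme \<Rightarrow> 'k^('b \<times> 'b) \<Rightarrow> 'k^('b \<times> 'b \<times> 'b)" where
  "leg12 H t = (\<chi> p. t $ (fst p, fst (snd p)) * \<one>\<^bsub>H\<^esub> $ snd (snd p))"

definition leg23 ::
    "('b::finite, 'k::field, 'm) alg_scheme \<Rightarrow> 'k^('b \<times> 'b) \<Rightarrow> 'k^('b \<times> 'b \<times> 'b)" where
  "leg23 H t = (\<chi> p. \<one>\<^bsub>H\<^esub> $ fst p * t $ (fst (snd p), snd (snd p)))"

definition leg13 ::
    "('b::finite, 'k::field, 'm) alg_scheme \<Rightarrow> 'k^('b \<times> 'b) \<Rightarrow> 'k^('b \<times> 'b \<times> 'b)" where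
  "leg13 H t = (\<chi> p. t $ (fst p, snd (snd p)) * \<one>\<^bsub>H\<^esub> $ fst (snd p))"

definition quasitriangular_structure ::
    "('b::finite, 'k::field, 'm) bialg_scheme \<Rightarrow> 'k^('b \<times> 'b) \<Rightarrow> bool" where
  "quasitriangular_structure H R \<longleftrightarrow>
    (\<exists>S. is_inverse (alg2 H) R S) \<and>
    (\<forall>u. coprod_op H u = R \<cdot>\<^bsub>alg2 H\<^esub> coprod H u \<cdot>\<^bsub>alg2 H\<^esub> alg_inv (alg2 H) R) \<and>
    id_coprod H R = leg13 H R \<cdot>\<^bsub>alg3 H\<^esub> leg12 H R \<and>
    coprod_id H R = leg13 H R \<cdot>\<^bsub>alg3 H\<^esub> leg23 H R"

definition infinitesimal_R_matrix ::
    "('b::finite, 'k::field, 'm) bialg_scheme \<Rightarrow> 'k^('b \<times> 'b) \<Rightarrow> 'k^('b \<times> 'b) \<Rightarrow> bool" where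
  "infinitesimal_R_matrix H R X \<longleftrightarrow>
    (\<forall>u. X \<cdot>\<^bsub>alg2 H\<^esub> coprod H u = coprod H u \<cdot>\<^bsub>alg2 H\<^esub> X) \<and>
    id_coprod H X = leg12 H X +
      alg_inv (alg3 H) (leg12 H R) \<cdot>\<^bsub>alg3 H\<^esub> leg13 H X \<cdot>\<^bsub>alg3 H\<^esub> leg12 H R \<and>
    coprod_id H X = leg23 H X +
      alg_inv (alg3 H) (leg23 H R) \<cdot>\<^bsub>alg3 H\<^esub> leg13 H X \<cdot>\<^bsub>alg3 H\<^esub> leg23 H R"


section \<open>The Hopf algebra\<close>

text \<open>\<open>(i, j, k)\<close> stands for the monomial \<open>g\<^sup>i h\<^sup>j x\<^sup>k\<close>, the exponents being read modulo 2
  for \<open>g\<close> and \<open>h\<close>.\<close>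

type_synonym monom = "bool \<times> bool \<times> bool"

text \<open>Moving \<open>x\<^sup>k\<close> past \<open>g\<^sup>i\<^sup>' h\<^sup>j\<^sup>'\<close> produces the sign \<open>(-1)\<^bsup>k(i' + j')\<^esup>\<close>.\<close>

fun mono_prod :: "monom \<Rightarrow> monom \<Rightarrow> ('k::field)^monom" where
  "mono_prod (i, j, k) (i', j', k') =
    (if k \<and> k' then 0
     else axis (i \<noteq> i', j \<noteq> j', k \<or> k') ((-1) ^ (of_bool k * (of_bool i' + of_bool j'))))"

definition A_alg :: "(monom, 'k::field) alg" where
  "A_alg = \<lparr>prod_basis = mono_prod, unit_vec = axis (False, False, False) 1\<rparr>"

definition gen_g :: "('k::field)^monom" where "gen_g = axis (True, False, False) 1"
definition gen_h :: "('k::field)^monom" where "gen_h = axis (False, True, False) 1"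
definition gen_x :: "('k::field)^monom" where "gen_x = axis (False, False, True) 1"

text \<open>The coproduct and the counit are extended from \<open>g, h, x\<close> as algebra homomorphisms and
  the antipode as an antihomomorphism.\<close>

fun A_coprod :: "monom \<Rightarrow> ('k::field)^(monom \<times> monom)" where
  "A_coprod (i, j, k) =
    alg_pow (alg2 A_alg) (gen_g \<otimes> gen_g) (of_bool i) \<cdot>\<^bsub>alg2 A_alg\<^esub>
    alg_pow (alg2 A_alg) (gen_h \<otimes> gen_h) (of_bool j) \<cdot>\<^bsub>alg2 A_alg\<^esub>
    alg_pow (alg2 A_alg) (\<one>\<^bsub>A_alg\<^esub> \<otimes> gen_x + gen_x \<otimes> gen_g) (of_bool k)"

fun A_counit :: "monom \<Rightarrow> 'k::field" where
  "A_counit (i, j, k) = 1 ^ of_bool i * 1 ^ of_bool j * 0 ^ of_bool k"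

fun A_antipode :: "monom \<Rightarrow> ('k::field)^monom" where
  "A_antipode (i, j, k) =
    alg_pow A_alg (- (gen_x \<cdot>\<^bsub>A_alg\<^esub> gen_g)) (of_bool k) \<cdot>\<^bsub>A_alg\<^esub>
    alg_pow A_alg gen_h (of_bool j) \<cdot>\<^bsub>A_alg\<^esub> alg_pow A_alg gen_g (of_bool i)"

definition A_C2C2 :: "(monom, 'k::field) hopf" where
  "A_C2C2 =
    \<lparr>prod_basis = prod_basis A_alg, unit_vec = unit_vec A_alg,
     coprod_basis = A_coprod, counit_basis = A_counit, antipode_basis = A_antipode\<rparr>"

definition R_q :: "nat \<Rightarrow> ('k::field)^(monom \<times> monom)" where
  "R_q q = (1 / 4) *s
    (\<Sum>i\<le>1. \<Sum>j\<le>1. \<Sum>k\<le>1. \<Sum>l\<le>1.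
      (-1) powi (- int (i * j) - int (k * l)) *s
      ((alg_pow A_C2C2 gen_g i \<cdot>\<^bsub>A_C2C2\<^esub> alg_pow A_C2C2 gen_h k) \<otimes>
       (alg_pow A_C2C2 gen_g (j + q * (j + l)) \<cdot>\<^bsub>A_C2C2\<^esub> alg_pow A_C2C2 gen_h (q * (j + l)))))"

definition R_a :: "nat \<Rightarrow> 'k::field \<Rightarrow> 'k^(monom \<times> monom)" where
  "R_a q a = R_q q \<cdot>\<^bsub>alg2 A_C2C2\<^esub>
    (\<one>\<^bsub>A_C2C2\<^esub> \<otimes> \<one>\<^bsub>A_C2C2\<^esub> + a *s (gen_x \<otimes> (gen_g \<cdot>\<^bsub>A_C2C2\<^esub> gen_x)))"

section \<open>Presentation, basis and Hopf algebra axioms for the model\<close>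

lemma vec_induct [case_names zero add axis]:
  assumes "P 0" and "\<And>u v. P u \<Longrightarrow> P v \<Longrightarrow> P (u + v)" and "\<And>b c. P (c *s axis b 1)"
  shows "P (u :: ('k::field)^('b::finite))"
proof -
  have "P (\<Sum>b\<in>F. (u $ b) *s axis b 1)" if "finite F" for F
    using that by (induction F) (auto intro: assms)
  moreover have "u = (\<Sum>b\<in>UNIV. (u $ b) *s axis b 1)"
    by (simp add: basis_expansion)
  ultimately show ?thesis by (metis finite)
qed

lemma lin_ext_simps [simp]:
  "lin_ext f 0 = 0" "lin_ext f (u + v) = lin_ext f u + lin_ext f v"
  "lin_ext f (c *s u) = c *s lin_ext f u" "lin_ext f (- u) = - lin_ext f u"
  "lin_ext f (axis b 1) = f b"
proof -
  show "lin_ext f (axis b 1) = f b"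
  proof -
    have "lin_ext f (axis b 1) = (\<Sum>b'\<in>UNIV. if b' = b then f b' else 0)"
      unfolding lin_ext_def by (rule sum.cong) (auto simp: axis_def)
    then show ?thesis by simp
  qed
qed (simp_all add: lin_ext_def vec.scale_left_distrib sum.distrib vec.scale_sum_right sum_negf)

lemma bilin_ext_conv: "bilin_ext f u v = lin_ext (\<lambda>b. lin_ext (f b) v) u"
  by (simp add: bilin_ext_def lin_ext_def vec.scale_sum_right)

lemma lin_ext_add_fun: "lin_ext (\<lambda>b. f b + g b) u = lin_ext f u + lin_ext g u"
  by (simp add: lin_ext_def vec.scale_right_distrib sum.distrib)

lemma lin_ext_scale_fun: "lin_ext (\<lambda>b. c *s f b) u = c *s lin_ext f u"
  by (simp add: lin_ext_def vec.scale_sum_right mult.commute)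

lemma lin_ext_uminus_fun: "lin_ext (\<lambda>b. - f b) u = - lin_ext f u"
  by (simp add: lin_ext_def sum_negf vec.scale_minus_right)

lemma lin_ext_zero_fun: "lin_ext (\<lambda>b. 0) u = 0"
  by (simp add: lin_ext_def)

lemma alg_mult_simps [simp]:
  "alg_mult H 0 v = 0" "alg_mult H v 0 = 0"
  "alg_mult H (u + u') v = alg_mult H u v + alg_mult H u' v"
  "alg_mult H v (u + u') = alg_mult H v u + alg_mult H v u'"
  "alg_mult H (c *s u) v = c *s alg_mult H u v"
  "alg_mult H v (c *s u) = c *s alg_mult H v u"
  "alg_mult H (- u) v = - alg_mult H u v"
  "alg_mult H v (- u) = - alg_mult H v u"
  "alg_mult H (axis b 1) (axis b' 1) = prod_basis H b b'"
  by (simp_all add: alg_mult_def bilin_ext_conv lin_ext_add_fun lin_ext_scale_fun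
      lin_ext_zero_fun lin_ext_uminus_fun)

lemma tensor_simps [simp]:
  "0 \<otimes> v = 0" "v \<otimes> 0 = 0"
  "(u + u') \<otimes> v = u \<otimes> v + u' \<otimes> v" "v \<otimes> (u + u') = v \<otimes> u + v \<otimes> u'"
  "(r *s u) \<otimes> v = r *s (u \<otimes> v)" "v' \<otimes> (r *s w) = r *s (v' \<otimes> w)"
  "(- u) \<otimes> v = - (u \<otimes> v)" "v \<otimes> (- u) = - (v \<otimes> u)"
  "axis b 1 \<otimes> axis c 1 = axis (b, c) (1 :: 'k::field)"
  by (auto simp: tensor_def vec_eq_iff algebra_simps axis_def)

lemma assoc_tensor_simps [simp]:
  "assoc_tensor (u + v) = assoc_tensor u + assoc_tensor v"
  "assoc_tensor (r *s u) = r *s assoc_tensor (u :: ('k::field)^_)"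
  "assoc_tensor (- u) = - assoc_tensor (u :: ('k::field)^_)"
  "assoc_tensor 0 = (0 :: ('k::field)^_)"
  "assoc_tensor (axis ((a, b), c) 1) = axis (a, b, c) (1 :: 'k::field)"
  by (auto simp: assoc_tensor_def vec_eq_iff axis_def)

lemma id_coprod_simps [simp]:
  "id_coprod H (u + v) = id_coprod H u + id_coprod H v"
  "id_coprod H (c *s u) = c *s id_coprod H u" "id_coprod H (- u) = - id_coprod H u"
  "id_coprod H 0 = 0" "id_coprod H (axis (a, b) 1) = axis a 1 \<otimes> coprod_basis H b"
  by (simp_all add: id_coprod_def map_tensor_right_def)

lemma coprod_id_simps [simp]:
  "coprod_id H (u + v) = coprod_id H u + coprod_id H v"
  "coprod_id H (c *s u) = c *s coprod_id H u" "coprod_id H (- u) = - coprod_id H u"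
  "coprod_id H 0 = 0"
  "coprod_id H (axis (a, b) 1) = assoc_tensor (coprod_basis H a \<otimes> axis b 1)"
  by (simp_all add: coprod_id_def map_tensor_left_def)

lemma coprod_simps [simp]:
  "coprod H (u + v) = coprod H u + coprod H v"
  "coprod H (c *s u) = c *s coprod H u" "coprod H (- u) = - coprod H u"
  "coprod H 0 = 0" "coprod H (axis b 1) = coprod_basis H b"
  by (simp_all add: coprod_def)

lemma counit_simps [simp]:
  "counit H (u + v) = counit H u + counit H v"
  "counit H (c *s u) = c * counit H u" "counit H (- u) = - counit H u"
  "counit H 0 = 0" "counit H (axis b 1) = counit_basis H b"
proof -
  show "counit H (axis b 1) = counit_basis H b"
  proof -
    have "counit H (axis b 1) = (\<Sum>b'\<in>UNIV. if b' = b then counit_basis H b' else 0)"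
      unfolding counit_def by (rule sum.cong) (auto simp: axis_def)
    then show ?thesis by simp
  qed
qed (simp_all add: counit_def algebra_simps sum.distrib sum_distrib_left sum_negf)

lemma axis_minus_one [simp]: "axis b (- 1 :: 'k::field) = - axis b 1"
  by (simp add: axis_def vec_eq_iff)

lemma axis_zero' [simp]: "axis b (0 :: 'k::field) = 0"
  by (simp add: axis_def vec_eq_iff)

lemma basis_simps [simp]:
  "prod_basis A_alg = mono_prod" "unit_vec A_alg = axis (False, False, False) 1"
  "prod_basis A_C2C2 = mono_prod" "unit_vec A_C2C2 = axis (False, False, False) 1"
  "coprod_basis A_C2C2 = A_coprod" "counit_basis A_C2C2 = A_counit"
  "antipode_basis A_C2C2 = A_antipode"
  "prod_basis (tensor_alg H K) (b, c) (b', c') = prod_basis H b b' \<otimes> prod_basis K c c'"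
  "unit_vec (tensor_alg H K) = unit_vec H \<otimes> unit_vec K"
  by (simp_all add: A_alg_def A_C2C2_def tensor_alg_def)

lemma A_relations:
  defines "m \<equiv> alg_mult A_C2C2"
  shows "m gen_g gen_g = \<one>\<^bsub>A_C2C2\<^esub>" "m gen_h gen_h = \<one>\<^bsub>A_C2C2\<^esub>" "m gen_x gen_x = 0"
    "m gen_g gen_h = m gen_h gen_g" "m gen_g gen_x = - m gen_x gen_g"
    "m gen_h gen_x = - m gen_x gen_h"
  by (simp_all add: m_def gen_g_def gen_h_def gen_x_def)

lemma A_basis:
  "axis (i, j, k) 1 = alg_pow A_C2C2 gen_g (of_bool i) \<cdot>\<^bsub>A_C2C2\<^esub>
     alg_pow A_C2C2 gen_h (of_bool j) \<cdot>\<^bsub>A_C2C2\<^esub> alg_pow A_C2C2 gen_x (of_bool k)"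
  by (cases i; cases j; cases k; simp add: gen_g_def gen_h_def gen_x_def)

lemma A_structure_maps:
  "coprod A_C2C2 gen_g = gen_g \<otimes> gen_g" "coprod A_C2C2 gen_h = gen_h \<otimes> gen_h"
  "coprod A_C2C2 gen_x = \<one>\<^bsub>A_C2C2\<^esub> \<otimes> gen_x + gen_x \<otimes> gen_g"
  "counit A_C2C2 gen_g = 1" "counit A_C2C2 gen_h = 1" "counit A_C2C2 gen_x = 0"
  "antipode A_C2C2 gen_g = gen_g" "antipode A_C2C2 gen_h = gen_h"
  "antipode A_C2C2 gen_x = - (gen_x \<cdot>\<^bsub>A_C2C2\<^esub> gen_g)"
  by (simp_all add: gen_g_def gen_h_def gen_x_def antipode_def)

lemma A_algebra: "is_algebra (A_C2C2 :: (monom, 'k::field) hopf)"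
proof -
  have basis: "(axis a 1 \<cdot>\<^bsub>A_C2C2\<^esub> axis b 1) \<cdot>\<^bsub>A_C2C2\<^esub> axis c (1 :: 'k) =
      axis a 1 \<cdot>\<^bsub>A_C2C2\<^esub> (axis b 1 \<cdot>\<^bsub>A_C2C2\<^esub> axis c 1)" for a b c :: monom
  proof -
    obtain a1 a2 a3 b1 b2 b3 c1 c2 c3
      where "a = (a1, a2, a3)" "b = (b1, b2, b3)" "c = (c1, c2, c3)" by (metis surj_pair)
    then show ?thesis
      by (cases a1; cases a2; cases a3; cases b1; cases b2; cases b3; cases c1; cases c2; cases c3;
          simp)
  qed
  have "(u \<cdot>\<^bsub>A_C2C2\<^esub> v) \<cdot>\<^bsub>A_C2C2\<^esub> w = u \<cdot>\<^bsub>A_C2C2\<^esub> (v \<cdot>\<^bsub>A_C2C2\<^esub> w)" for u v w :: "'k^monom"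
  proof (induction u rule: vec_induct)
    case (axis a x)
    show ?case
    proof (induction v rule: vec_induct)
      case (axis b y)
      show ?case
        by (induction w rule: vec_induct) (auto simp: basis[simplified] vec.scale_right_distrib)
    qed (auto simp: vec.scale_right_distrib)
  qed auto
  moreover have "\<one>\<^bsub>A_C2C2\<^esub> \<cdot>\<^bsub>A_C2C2\<^esub> u = u" "u \<cdot>\<^bsub>A_C2C2\<^esub> \<one>\<^bsub>A_C2C2\<^esub> = u" for u :: "'k^monom"
    by (induction u rule: vec_induct) auto
  ultimately show ?thesis by (simp add: is_algebra_def)
qed

lemma A_coprod_mult:
  "coprod A_C2C2 (u \<cdot>\<^bsub>A_C2C2\<^esub> v) = coprod A_C2C2 u \<cdot>\<^bsub>alg2 A_C2C2\<^esub> coprod A_C2C2 (v :: ('k::field)^monom)"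
proof -
  have basis: "coprod A_C2C2 (axis a 1 \<cdot>\<^bsub>A_C2C2\<^esub> axis b 1) =
      coprod A_C2C2 (axis a 1) \<cdot>\<^bsub>alg2 A_C2C2\<^esub> coprod A_C2C2 (axis b (1 :: 'k))" for a b :: monom
  proof -
    obtain a1 a2 a3 b1 b2 b3
      where "a = (a1, a2, a3)" "b = (b1, b2, b3)" by (metis surj_pair)
    then show ?thesis
      by (cases a1; cases a2; cases a3; cases b1; cases b2; cases b3;
          simp add: gen_g_def gen_h_def gen_x_def)
  qed
  show ?thesis
  proof (induction u rule: vec_induct)
    case (axis a x)
    show ?case
      by (induction v rule: vec_induct) (auto simp: basis[simplified] vec.scale_right_distrib)
  qed auto
qed

lemma A_bialgebra: "is_bialgebra (A_C2C2 :: (monom, 'k::field) hopf)"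
proof -
  let ?H = "A_C2C2 :: (monom, 'k) hopf"
  have mono: "P a" if "\<And>i j k. P (i, j, k)" for P and a :: monom
    using that by (metis surj_pair)
  have "id_coprod ?H (A_coprod a) = coprod_id ?H (A_coprod a)" for a
    by (induction a rule: mono) (case_tac i; case_tac j; case_tac k;
        simp add: gen_g_def gen_h_def gen_x_def)
  then have "id_coprod ?H (coprod ?H u) = coprod_id ?H (coprod ?H u)" for u
    by (induction u rule: vec_induct) simp_all
  moreover have "lin_ext (\<lambda>(a, b). counit_basis ?H a *s axis b 1) (A_coprod a) = axis a 1 \<and>
      lin_ext (\<lambda>(a, b). counit_basis ?H b *s axis a 1) (A_coprod a) = axis a 1" for a
    by (induction a rule: mono) (case_tac i; case_tac j; case_tac k;
        simp add: gen_g_def gen_h_def gen_x_def)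
  then have "lin_ext (\<lambda>(a, b). counit_basis ?H a *s axis b 1) (coprod ?H u) = u \<and>
      lin_ext (\<lambda>(a, b). counit_basis ?H b *s axis a 1) (coprod ?H u) = u" for u
    by (induction u rule: vec_induct) simp_all
  moreover have "counit ?H (mono_prod a b) = A_counit a * A_counit b" for a b
  proof -
    obtain a1 a2 a3 b1 b2 b3
      where "a = (a1, a2, a3)" "b = (b1, b2, b3)" by (metis surj_pair)
    then show ?thesis
      by (cases a1; cases a2; cases a3; cases b1; cases b2; cases b3; simp)
  qed
  then have "counit ?H (u \<cdot>\<^bsub>?H\<^esub> v) = counit ?H u * counit ?H v" for u v
  proof (induction u rule: vec_induct)
    case (axis a x)
    then show ?case
      by (induction v rule: vec_induct) (auto simp: algebra_simps)
  qed (auto simp: algebra_simps)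
  ultimately show ?thesis
    by (simp add: is_bialgebra_def A_algebra A_coprod_mult)
qed

lemma A_hopf: "is_hopf_algebra (A_C2C2 :: (monom, 'k::field) hopf)"
proof -
  let ?H = "A_C2C2 :: (monom, 'k) hopf"
  have "lin_ext (\<lambda>(a, b). antipode_basis ?H a \<cdot>\<^bsub>?H\<^esub> axis b 1) (A_coprod a) = A_counit a *s \<one>\<^bsub>?H\<^esub> \<and>
      lin_ext (\<lambda>(a, b). axis a 1 \<cdot>\<^bsub>?H\<^esub> antipode_basis ?H b) (A_coprod a) = A_counit a *s \<one>\<^bsub>?H\<^esub>"
    for a
  proof -
    obtain i j k where "a = (i, j, k)" by (metis surj_pair)
    then show ?thesis
      by (cases i; cases j; cases k; simp add: gen_g_def gen_h_def gen_x_def)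
  qed
  then have "lin_ext (\<lambda>(a, b). antipode_basis ?H a \<cdot>\<^bsub>?H\<^esub> axis b 1) (coprod ?H u) = counit ?H u *s \<one>\<^bsub>?H\<^esub> \<and>
      lin_ext (\<lambda>(a, b). axis a 1 \<cdot>\<^bsub>?H\<^esub> antipode_basis ?H b) (coprod ?H u) = counit ?H u *s \<one>\<^bsub>?H\<^esub>"
    for u
    by (induction u rule: vec_induct) (simp_all add: vec.scale_left_distrib)
  then show ?thesis by (simp add: is_hopf_algebra_def A_bialgebra)
qed


section \<open>The elements \<open>R_a\<close> are quasitriangular structures\<close>

lemma tensor_mult:
  "(u \<otimes> v) \<cdot>\<^bsub>tensor_alg H K\<^esub> (u' \<otimes> v') = (u \<cdot>\<^bsub>H\<^esub> u') \<otimes> (v \<cdot>\<^bsub>K\<^esub> v')"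
proof -
  have ax: "(axis a 1 \<otimes> axis b 1) \<cdot>\<^bsub>tensor_alg H K\<^esub> (axis a' 1 \<otimes> axis b' 1) =
      (axis a 1 \<cdot>\<^bsub>H\<^esub> axis a' 1) \<otimes> (axis b 1 \<cdot>\<^bsub>K\<^esub> axis b' 1)" for a a' b b'
    by simp
  show ?thesis
  proof (induction u rule: vec_induct)
    case u: (axis a x)
    show ?case
    proof (induction v rule: vec_induct)
      case v: (axis b y)
      show ?case
      proof (induction u' rule: vec_induct)
        case u': (axis a' x')
        show ?case
          by (induction v' rule: vec_induct) (auto simp: vec.scale_right_distrib mult_ac)
      qed (auto simp: vec.scale_right_distrib)
    qed (auto simp: vec.scale_right_distrib)
  qed simp_all
qed

lemma tensor_algebra:
  assumes H: "is_algebra H" and K: "is_algebra K"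
  shows "is_algebra (tensor_alg H K)"
proof -
  let ?T = "tensor_alg H K"
  have gen: "P (axis p 1)" if "\<And>u v. P (u \<otimes> v)" for P p
    using that[of "axis (fst p) 1" "axis (snd p) 1"] by simp
  have ax: "(axis a 1 \<cdot>\<^bsub>?T\<^esub> axis b 1) \<cdot>\<^bsub>?T\<^esub> axis c 1 = axis a 1 \<cdot>\<^bsub>?T\<^esub> (axis b 1 \<cdot>\<^bsub>?T\<^esub> axis c 1)" for a b c
    by (rule gen[of _ a], rule gen[of _ b], rule gen[of _ c])
      (use H K in \<open>simp add: tensor_mult is_algebra_def\<close>)
  have "(u \<cdot>\<^bsub>?T\<^esub> v) \<cdot>\<^bsub>?T\<^esub> w = u \<cdot>\<^bsub>?T\<^esub> (v \<cdot>\<^bsub>?T\<^esub> w)" for u v w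
  proof (induction u rule: vec_induct)
    case (axis a x)
    show ?case
    proof (induction v rule: vec_induct)
      case (axis b y)
      show ?case
        by (induction w rule: vec_induct)
          (auto simp: ax vec.scale_right_distrib mult_ac simp del: alg_mult_simps(9))
    qed (auto simp: vec.scale_right_distrib)
  qed simp_all
  moreover have "\<one>\<^bsub>?T\<^esub> \<cdot>\<^bsub>?T\<^esub> axis p 1 = axis p 1 \<and> axis p 1 \<cdot>\<^bsub>?T\<^esub> \<one>\<^bsub>?T\<^esub> = axis p 1" for p
    by (rule gen) (use H K in \<open>simp add: tensor_mult is_algebra_def\<close>)
  then have "\<one>\<^bsub>?T\<^esub> \<cdot>\<^bsub>?T\<^esub> u = u" "u \<cdot>\<^bsub>?T\<^esub> \<one>\<^bsub>?T\<^esub> = u" for u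
    by (induction u rule: vec_induct) (simp_all del: basis_simps)
  ultimately show ?thesis by (simp add: is_algebra_def)
qed

lemma leg_simps [simp]:
  "leg12 H (u + v) = leg12 H u + leg12 H v" "leg12 H (c *s u) = c *s leg12 H u"
  "leg12 H (- u) = - leg12 H u" "leg12 H 0 = 0"
  "leg23 H (u + v) = leg23 H u + leg23 H v" "leg23 H (c *s u) = c *s leg23 H u"
  "leg23 H (- u) = - leg23 H u" "leg23 H 0 = 0"
  "leg13 H (u + v) = leg13 H u + leg13 H v" "leg13 H (c *s u) = c *s leg13 H u"
  "leg13 H (- u) = - leg13 H u" "leg13 H 0 = 0"
  by (simp_all add: leg12_def leg23_def leg13_def vec_eq_iff algebra_simps)

lemma leg_axis [simp]:
  "leg12 H (axis (a, b) 1) = axis a 1 \<otimes> axis b 1 \<otimes> \<one>\<^bsub>H\<^esub>"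
  "leg23 H (axis (a, b) 1) = \<one>\<^bsub>H\<^esub> \<otimes> axis a 1 \<otimes> axis b 1"
  "leg13 H (axis (a, b) 1) = axis a 1 \<otimes> \<one>\<^bsub>H\<^esub> \<otimes> axis b 1"
  by (auto simp: leg12_def leg23_def leg13_def tensor_def vec_eq_iff axis_def)

lemma leg_tensor:
  "leg12 H (u \<otimes> v) = u \<otimes> v \<otimes> \<one>\<^bsub>H\<^esub>"
  "leg23 H (u \<otimes> v) = \<one>\<^bsub>H\<^esub> \<otimes> u \<otimes> v"
  "leg13 H (u \<otimes> v) = u \<otimes> \<one>\<^bsub>H\<^esub> \<otimes> v"
  by (auto simp: leg12_def leg23_def leg13_def tensor_def vec_eq_iff algebra_simps)

lemma vec_bilinear_eqI:
  fixes f :: "('k::field)^('a::finite) \<Rightarrow> 'k^('b::finite) \<Rightarrow> 'k^('c::finite)"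
  assumes "\<And>a b. f (axis a 1) (axis b 1) = g (axis a 1) (axis b 1)"
    and "\<And>v. f 0 v = 0" "\<And>u. f u 0 = 0" "\<And>v. g 0 v = 0" "\<And>u. g u 0 = 0"
    and "\<And>u u' v. f (u + u') v = f u v + f u' v" "\<And>u u' v. g (u + u') v = g u v + g u' v"
    and "\<And>u v v'. f u (v + v') = f u v + f u v'" "\<And>u v v'. g u (v + v') = g u v + g u v'"
    and "\<And>c u v. f (c *s u) v = c *s f u v" "\<And>c u v. g (c *s u) v = c *s g u v"
    and "\<And>c u v. f u (c *s v) = c *s f u v" "\<And>c u v. g u (c *s v) = c *s g u v"
  shows "f u v = g u v"
proof (induction u rule: vec_induct)
  case (axis a x)
  show ?case
    by (induction v rule: vec_induct) (auto simp: assms vec.scale_right_distrib)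
qed (simp_all add: assms)

lemma leg_mult:
  assumes "is_algebra H"
  shows "leg12 H (s \<cdot>\<^bsub>alg2 H\<^esub> t) = leg12 H s \<cdot>\<^bsub>alg3 H\<^esub> leg12 H t"
    "leg23 H (s \<cdot>\<^bsub>alg2 H\<^esub> t) = leg23 H s \<cdot>\<^bsub>alg3 H\<^esub> leg23 H t"
    "leg13 H (s \<cdot>\<^bsub>alg2 H\<^esub> t) = leg13 H s \<cdot>\<^bsub>alg3 H\<^esub> leg13 H t"
proof -
  have gen: "P (axis p 1) (axis q 1)" if "\<And>u v u' v'. P (u \<otimes> v) (u' \<otimes> v')" for P p q
    using that[of "axis (fst p) 1" "axis (snd p) 1" "axis (fst q) 1" "axis (snd q) 1"] by simp
  show "leg12 H (s \<cdot>\<^bsub>alg2 H\<^esub> t) = leg12 H s \<cdot>\<^bsub>alg3 H\<^esub> leg12 H t"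
    by (rule vec_bilinear_eqI[where f = "\<lambda>s t. leg12 H (s \<cdot>\<^bsub>alg2 H\<^esub> t)"])
      (rule gen, use assms in \<open>simp_all add: leg_tensor tensor_mult is_algebra_def del: leg_axis\<close>)
  show "leg23 H (s \<cdot>\<^bsub>alg2 H\<^esub> t) = leg23 H s \<cdot>\<^bsub>alg3 H\<^esub> leg23 H t"
    by (rule vec_bilinear_eqI[where f = "\<lambda>s t. leg23 H (s \<cdot>\<^bsub>alg2 H\<^esub> t)"])
      (rule gen, use assms in \<open>simp_all add: leg_tensor tensor_mult is_algebra_def del: leg_axis\<close>)
  show "leg13 H (s \<cdot>\<^bsub>alg2 H\<^esub> t) = leg13 H s \<cdot>\<^bsub>alg3 H\<^esub> leg13 H t"
    by (rule vec_bilinear_eqI[where f = "\<lambda>s t. leg13 H (s \<cdot>\<^bsub>alg2 H\<^esub> t)"])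
      (rule gen, use assms in \<open>simp_all add: leg_tensor tensor_mult is_algebra_def del: leg_axis\<close>)
qed

lemma id_coprod_tensor: "id_coprod H (u \<otimes> v) = u \<otimes> coprod H v"
  by (rule vec_bilinear_eqI[where f = "\<lambda>u v. id_coprod H (u \<otimes> v)"]) simp_all

lemma coprod_id_tensor: "coprod_id H (u \<otimes> v) = assoc_tensor (coprod H u \<otimes> v)"
  by (rule vec_bilinear_eqI[where f = "\<lambda>u v. coprod_id H (u \<otimes> v)"]) simp_all

lemma assoc_tensor_mult:
  fixes H :: "('b::finite, 'k::field, 'm) alg_scheme"
  shows
  "assoc_tensor (s \<cdot>\<^bsub>tensor_alg (alg2 H) H\<^esub> t) = assoc_tensor s \<cdot>\<^bsub>alg3 H\<^esub> assoc_tensor t"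
proof (rule vec_bilinear_eqI[where f = "\<lambda>s t. assoc_tensor (s \<cdot>\<^bsub>tensor_alg (alg2 H) H\<^esub> t)"])
  have a: "assoc_tensor ((u \<otimes> v) \<otimes> w) = u \<otimes> v \<otimes> w" for u v w :: "'k^'b"
    by (simp add: assoc_tensor_def tensor_def vec_eq_iff mult_ac)
  fix p q :: "('b \<times> 'b) \<times> 'b"
  obtain a b c a' b' c' where "p = ((a, b), c)" "q = ((a', b'), c')" by (metis surj_pair)
  then show "assoc_tensor (axis p 1 \<cdot>\<^bsub>tensor_alg (alg2 H) H\<^esub> axis q 1) =
      assoc_tensor (axis p 1) \<cdot>\<^bsub>alg3 H\<^esub> assoc_tensor (axis q 1)"
    by (simp add: a)
qed simp_all

lemma A_id_coprod_mult:
  "id_coprod A_C2C2 (s \<cdot>\<^bsub>alg2 A_C2C2\<^esub> t) = id_coprod A_C2C2 s \<cdot>\<^bsub>alg3 A_C2C2\<^esub> id_coprod A_C2C2 t"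
  "coprod_id A_C2C2 (s \<cdot>\<^bsub>alg2 A_C2C2\<^esub> t) = coprod_id A_C2C2 s \<cdot>\<^bsub>alg3 A_C2C2\<^esub> coprod_id A_C2C2 t"
proof -
  have gen: "P (axis p 1) (axis q 1)" if "\<And>u v u' v'. P (u \<otimes> v) (u' \<otimes> v')"
    for P and p q :: "monom \<times> monom"
    using that[of "axis (fst p) 1" "axis (snd p) 1" "axis (fst q) 1" "axis (snd q) 1"] by simp
  show "id_coprod A_C2C2 (s \<cdot>\<^bsub>alg2 A_C2C2\<^esub> t) =
      id_coprod A_C2C2 s \<cdot>\<^bsub>alg3 A_C2C2\<^esub> id_coprod A_C2C2 t"
    by (rule vec_bilinear_eqI[where f = "\<lambda>s t. id_coprod A_C2C2 (s \<cdot>\<^bsub>alg2 A_C2C2\<^esub> t)"])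
      (rule gen, simp_all add: id_coprod_tensor tensor_mult A_coprod_mult)
  show "coprod_id A_C2C2 (s \<cdot>\<^bsub>alg2 A_C2C2\<^esub> t) =
      coprod_id A_C2C2 s \<cdot>\<^bsub>alg3 A_C2C2\<^esub> coprod_id A_C2C2 t"
    by (rule vec_bilinear_eqI[where f = "\<lambda>s t. coprod_id A_C2C2 (s \<cdot>\<^bsub>alg2 A_C2C2\<^esub> t)"])
      (rule gen, simp_all add: coprod_id_tensor tensor_mult A_coprod_mult
        flip: assoc_tensor_mult)
qed

abbreviation (input) "mon_1 \<equiv> (False, False, False)"
abbreviation (input) "mon_g \<equiv> (True, False, False)"
abbreviation (input) "mon_h \<equiv> (False, True, False)"
abbreviation (input) "mon_gh \<equiv> (True, True, False)"
abbreviation (input) "mon_x \<equiv> (False, False, True)"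
abbreviation (input) "mon_gx \<equiv> (True, False, True)"

text \<open>\<open>F4 u v\<close> is \<open>1 \<otimes> 1 + u \<otimes> 1 + 1 \<otimes> v - u \<otimes> v\<close>, twice the bicharacter R-matrix of the pair \<open>(u, v)\<close>;
  \<open>R_0 = F4 g g / 2\<close> and \<open>R_1 = (F4 g h / 2)(F4 h gh / 2)\<close>.\<close>

definition F4 :: "monom \<Rightarrow> monom \<Rightarrow> ('k::field)^(monom \<times> monom)" where
  "F4 u v = axis (mon_1, mon_1) 1 + axis (u, mon_1) 1 + axis (mon_1, v) 1 - axis (u, v) 1"

definition N4 :: "'k \<Rightarrow> ('k::field)^(monom \<times> monom)" where
  "N4 a = axis (mon_1, mon_1) 1 + a *s axis (mon_x, mon_gx) 1"

definition N5 :: "monom \<Rightarrow> 'k \<Rightarrow> ('k::field)^(monom \<times> monom \<times> monom)" where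
  "N5 c a = axis (mon_1, mon_1, mon_1) 1 + a *s axis (mon_x, c, mon_gx) 1"

lemma vec_two: "(2 :: 'k::field) *s u = u + u" "(4 :: 'k::field) *s u = u + u + u + u"
  by (simp_all add: vec_eq_iff)

lemma alg_mult_diff [simp]:
  "alg_mult H (u - u') v = alg_mult H u v - alg_mult H u' v"
  "alg_mult H v (u - u') = alg_mult H v u - alg_mult H v u'"
  by (simp_all only: diff_conv_add_uminus alg_mult_simps)

lemma lin_diff [simp]:
  "leg12 H (s - t) = leg12 H s - leg12 H t" "leg13 H (s - t) = leg13 H s - leg13 H t"
  "leg23 H (s - t) = leg23 H s - leg23 H t" "id_coprod G (s - t) = id_coprod G s - id_coprod G t"
  "coprod_id G (s - t) = coprod_id G s - coprod_id G t"
  by (simp_all only: diff_conv_add_uminus leg_simps id_coprod_simps coprod_id_simps)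

lemma R_q_F4:
  assumes "(2 :: 'k::field) \<noteq> 0"
  shows "R_q 0 = (1 / 2 :: 'k) *s F4 mon_g mon_g"
    "R_q (Suc 0) = (1 / 4 :: 'k) *s (F4 mon_g mon_h \<cdot>\<^bsub>alg2 A_C2C2\<^esub> F4 mon_h mon_gh)"
proof -
  have [simp]: "(-1 :: 'k) powi (- 1 - 1) = 1" by (simp add: power_int_def)
  let ?S = "\<lambda>q. \<Sum>i\<le>1. \<Sum>j\<le>1. \<Sum>k\<le>1. \<Sum>l\<le>1.
      (-1 :: 'k) powi (- int (i * j) - int (k * l)) *s
      ((alg_pow A_C2C2 gen_g i \<cdot>\<^bsub>A_C2C2\<^esub> alg_pow A_C2C2 gen_h k) \<otimes>
       (alg_pow A_C2C2 gen_g (j + q * (j + l)) \<cdot>\<^bsub>A_C2C2\<^esub> alg_pow A_C2C2 gen_h (q * (j + l))))"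
  have half: "(1 / 4 :: 'k) *s (u + u) = (1 / 2) *s u" for u :: "'k^(monom \<times> monom)"
  proof -
    have "(1 / 4 :: 'k) *s (u + u) = (2 / 4) *s u"
      by (simp add: vec_eq_iff)
    also have "(2 / 4 :: 'k) = 2 / (2 * 2)" by simp
    also have "\<dots> = 1 / 2" by (simp only: divide_divide_eq_left[symmetric] divide_self[OF assms])
    finally show ?thesis .
  qed
  have S: "?S 0 = F4 mon_g mon_g + F4 mon_g mon_g"
    by (simp add: F4_def gen_g_def gen_h_def atMost_Suc algebra_simps)
  show "R_q 0 = (1 / 2 :: 'k) *s F4 mon_g mon_g"
    unfolding R_q_def S half ..
  have S: "?S (Suc 0) = F4 mon_g mon_h \<cdot>\<^bsub>alg2 A_C2C2\<^esub> F4 mon_h mon_gh"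
    by (simp add: F4_def gen_g_def gen_h_def atMost_Suc algebra_simps)
  show "R_q (Suc 0) = (1 / 4 :: 'k) *s (F4 mon_g mon_h \<cdot>\<^bsub>alg2 A_C2C2\<^esub> F4 mon_h mon_gh)"
    unfolding R_q_def S ..
qed

definition "FP u v \<longleftrightarrow> (u, v) \<in> {(mon_g, mon_g), (mon_g, mon_h), (mon_h, mon_gh)}"

lemma F4_facts:
  assumes "FP u v"
  shows "F4 u v \<cdot>\<^bsub>alg2 A_C2C2\<^esub> F4 u v = 4 *s axis (mon_1, mon_1) (1 :: 'k::field)"
    "(2 :: 'k) *s id_coprod A_C2C2 (F4 u v) =
      leg13 A_C2C2 (F4 u v) \<cdot>\<^bsub>alg3 A_C2C2\<^esub> leg12 A_C2C2 (F4 u v)"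
    "(2 :: 'k) *s coprod_id A_C2C2 (F4 u v) =
      leg13 A_C2C2 (F4 u v) \<cdot>\<^bsub>alg3 A_C2C2\<^esub> leg23 A_C2C2 (F4 u v)"
  using assms
  by (auto simp: FP_def F4_def vec_two gen_g_def gen_h_def algebra_simps tensor_mult)

lemma F4_comm:
  assumes "FP u v" "FP u' v'"
  shows "leg12 A_C2C2 (F4 u v) \<cdot>\<^bsub>alg3 A_C2C2\<^esub> leg13 A_C2C2 (F4 u' v') =
      leg13 A_C2C2 (F4 u' v') \<cdot>\<^bsub>alg3 A_C2C2\<^esub> leg12 A_C2C2 (F4 u v :: ('k::field)^_)"
    "leg23 A_C2C2 (F4 u v) \<cdot>\<^bsub>alg3 A_C2C2\<^esub> leg13 A_C2C2 (F4 u' v') =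
      leg13 A_C2C2 (F4 u' v') \<cdot>\<^bsub>alg3 A_C2C2\<^esub> leg23 A_C2C2 (F4 u v :: ('k::field)^_)"
  using assms
  by (auto simp: FP_def F4_def gen_g_def gen_h_def algebra_simps tensor_mult)

lemma N4_facts:
  "N4 a \<cdot>\<^bsub>alg2 A_C2C2\<^esub> N4 (- a) = axis (mon_1, mon_1) (1 :: 'k::field)"
  "id_coprod A_C2C2 (N4 a) = N5 mon_g a \<cdot>\<^bsub>alg3 A_C2C2\<^esub> leg12 A_C2C2 (N4 a)"
  "coprod_id A_C2C2 (N4 a) = N5 mon_g a \<cdot>\<^bsub>alg3 A_C2C2\<^esub> leg23 A_C2C2 (N4 a)"
  "leg13 A_C2C2 (N4 a) = N5 mon_1 a"
  "N4 a \<cdot>\<^bsub>alg2 A_C2C2\<^esub> A_coprod b = A_coprod b \<cdot>\<^bsub>alg2 A_C2C2\<^esub> N4 a"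
proof -
  obtain i j k where "b = (i, j, k)" by (metis surj_pair)
  then show "N4 a \<cdot>\<^bsub>alg2 A_C2C2\<^esub> A_coprod b = A_coprod b \<cdot>\<^bsub>alg2 A_C2C2\<^esub> N4 a"
    by (cases i; cases j; cases k; simp add: N4_def gen_g_def gen_h_def gen_x_def algebra_simps)
qed (simp_all add: N4_def N5_def gen_g_def gen_h_def gen_x_def algebra_simps tensor_mult)

lemma N5_F4:
  fixes a :: "'k::field"
  shows
  "N5 mon_1 a \<cdot>\<^bsub>alg3 A_C2C2\<^esub> leg12 A_C2C2 (F4 mon_g mon_g) = leg12 A_C2C2 (F4 mon_g mon_g) \<cdot>\<^bsub>alg3 A_C2C2\<^esub> N5 mon_g a"
  "N5 mon_1 a \<cdot>\<^bsub>alg3 A_C2C2\<^esub> leg23 A_C2C2 (F4 mon_g mon_g) = leg23 A_C2C2 (F4 mon_g mon_g) \<cdot>\<^bsub>alg3 A_C2C2\<^esub> N5 mon_g a"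
  "N5 mon_1 a \<cdot>\<^bsub>alg3 A_C2C2\<^esub> leg12 A_C2C2 (F4 mon_g mon_h) = leg12 A_C2C2 (F4 mon_g mon_h) \<cdot>\<^bsub>alg3 A_C2C2\<^esub> N5 mon_h a"
  "N5 mon_h a \<cdot>\<^bsub>alg3 A_C2C2\<^esub> leg12 A_C2C2 (F4 mon_h mon_gh) = leg12 A_C2C2 (F4 mon_h mon_gh) \<cdot>\<^bsub>alg3 A_C2C2\<^esub> N5 mon_g a"
  "N5 mon_1 a \<cdot>\<^bsub>alg3 A_C2C2\<^esub> leg23 A_C2C2 (F4 mon_g mon_h) = leg23 A_C2C2 (F4 mon_g mon_h) \<cdot>\<^bsub>alg3 A_C2C2\<^esub> N5 mon_g a"
  "N5 mon_g a \<cdot>\<^bsub>alg3 A_C2C2\<^esub> leg23 A_C2C2 (F4 mon_h mon_gh) = leg23 A_C2C2 (F4 mon_h mon_gh) \<cdot>\<^bsub>alg3 A_C2C2\<^esub> N5 mon_g a"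
  by (simp_all add: N5_def F4_def algebra_simps tensor_mult)

text \<open>\<open>T4 (i, j, k)\<close> is \<open>(g\<^sup>ih\<^sup>j \<otimes> g\<^sup>ih\<^sup>j)(1 \<otimes> x + x \<otimes> h)\<^sup>k\<close>.\<close>

definition T4 :: "monom \<Rightarrow> ('k::field)^(monom \<times> monom)" where
  "T4 b = (case b of (i, j, k) \<Rightarrow>
    axis ((i, j, False), (i, j, False)) 1 \<cdot>\<^bsub>alg2 A_C2C2\<^esub>
    (if k then axis (mon_1, mon_x) 1 + axis (mon_x, mon_h) 1 else axis (mon_1, mon_1) 1))"

lemma F4_coprod:
  fixes b :: monom
  shows "(F4 mon_g mon_g :: ('k::field)^(monom \<times> monom)) \<cdot>\<^bsub>alg2 A_C2C2\<^esub> A_coprod b = flip (A_coprod b) \<cdot>\<^bsub>alg2 A_C2C2\<^esub> F4 mon_g mon_g"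
  "(F4 mon_g mon_h :: 'k^(monom \<times> monom)) \<cdot>\<^bsub>alg2 A_C2C2\<^esub> T4 b = flip (A_coprod b) \<cdot>\<^bsub>alg2 A_C2C2\<^esub> F4 mon_g mon_h"
  "(F4 mon_h mon_gh :: 'k^(monom \<times> monom)) \<cdot>\<^bsub>alg2 A_C2C2\<^esub> A_coprod b = T4 b \<cdot>\<^bsub>alg2 A_C2C2\<^esub> F4 mon_h mon_gh"
proof -
  have [simp]: "flip (u + v) = flip u + flip v" "flip (axis (p, q) 1) = axis (q, p) (1 :: 'k)"
     "flip (- u) = - flip (u :: 'k^_)" "flip 0 = (0 :: 'k^_)"
    for u v :: "'k^(monom \<times> monom)" and p q
    by (auto simp: flip_def vec_eq_iff axis_def)
  obtain i j k where "b = (i, j, k)" by (metis surj_pair)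
  then show "(F4 mon_g mon_g :: 'k^(monom \<times> monom)) \<cdot>\<^bsub>alg2 A_C2C2\<^esub> A_coprod b = flip (A_coprod b) \<cdot>\<^bsub>alg2 A_C2C2\<^esub> F4 mon_g mon_g"
  "(F4 mon_g mon_h :: 'k^(monom \<times> monom)) \<cdot>\<^bsub>alg2 A_C2C2\<^esub> T4 b = flip (A_coprod b) \<cdot>\<^bsub>alg2 A_C2C2\<^esub> F4 mon_g mon_h"
  "(F4 mon_h mon_gh :: 'k^(monom \<times> monom)) \<cdot>\<^bsub>alg2 A_C2C2\<^esub> A_coprod b = T4 b \<cdot>\<^bsub>alg2 A_C2C2\<^esub> F4 mon_h mon_gh"
    by (cases i; cases j; cases k; simp add: F4_def T4_def gen_g_def gen_h_def gen_x_def algebra_simps)+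
qed
lemma alg_inv_eqI:
  assumes "is_algebra H" "is_inverse H u v"
  shows "alg_inv H u = v"
  unfolding alg_inv_def using assms
  by (intro the_equality) (auto simp: is_inverse_def is_algebra_def, metis)

lemma quasitriangular_from_R_q:
  fixes Q :: "('k::field)^(monom \<times> monom)"
  defines "H \<equiv> A_C2C2"
  assumes inv: "Q \<cdot>\<^bsub>alg2 H\<^esub> Q = axis (mon_1, mon_1) 1"
    and id_cop: "id_coprod H Q = leg13 H Q \<cdot>\<^bsub>alg3 H\<^esub> leg12 H Q"
    and cop_id: "coprod_id H Q = leg13 H Q \<cdot>\<^bsub>alg3 H\<^esub> leg23 H Q"
    and flip: "\<And>b. Q \<cdot>\<^bsub>alg2 H\<^esub> A_coprod b = flip (A_coprod b) \<cdot>\<^bsub>alg2 H\<^esub> Q"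
    and N12: "N5 mon_1 a \<cdot>\<^bsub>alg3 H\<^esub> leg12 H Q = leg12 H Q \<cdot>\<^bsub>alg3 H\<^esub> N5 mon_g a"
    and N23: "N5 mon_1 a \<cdot>\<^bsub>alg3 H\<^esub> leg23 H Q = leg23 H Q \<cdot>\<^bsub>alg3 H\<^esub> N5 mon_g a"
  shows "quasitriangular_structure A_C2C2 (Q \<cdot>\<^bsub>alg2 A_C2C2\<^esub> N4 a)"
proof -
  have H: "is_algebra H" unfolding H_def by (rule A_algebra)
  have H2: "is_algebra (alg2 H)" by (intro tensor_algebra H)
  have H3: "is_algebra (alg3 H)" by (intro tensor_algebra H)
  have assoc2: "u \<cdot>\<^bsub>alg2 H\<^esub> v \<cdot>\<^bsub>alg2 H\<^esub> w = u \<cdot>\<^bsub>alg2 H\<^esub> (v \<cdot>\<^bsub>alg2 H\<^esub> w)" for u v w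
    using H2 by (simp add: is_algebra_def)
  have assoc3: "u \<cdot>\<^bsub>alg3 H\<^esub> v \<cdot>\<^bsub>alg3 H\<^esub> w = u \<cdot>\<^bsub>alg3 H\<^esub> (v \<cdot>\<^bsub>alg3 H\<^esub> w)" for u v w
    using H3 by (simp add: is_algebra_def)
  have one2: "\<one>\<^bsub>alg2 H\<^esub> = axis (mon_1, mon_1) 1" by (simp add: H_def)
  have unit: "axis (mon_1, mon_1) 1 \<cdot>\<^bsub>alg2 H\<^esub> u = u" "u \<cdot>\<^bsub>alg2 H\<^esub> axis (mon_1, mon_1) 1 = u" for u
    using H2 unfolding is_algebra_def one2 by auto
  let ?R = "Q \<cdot>\<^bsub>alg2 H\<^esub> N4 a" and ?S = "N4 (- a) \<cdot>\<^bsub>alg2 H\<^esub> Q"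
  have NN: "N4 a \<cdot>\<^bsub>alg2 H\<^esub> N4 (- a) = axis (mon_1, mon_1) 1" for a :: 'k
    unfolding H_def by (rule N4_facts)
  have RS: "?R \<cdot>\<^bsub>alg2 H\<^esub> ?S = axis (mon_1, mon_1) 1"
  proof -
    have "?R \<cdot>\<^bsub>alg2 H\<^esub> ?S = Q \<cdot>\<^bsub>alg2 H\<^esub> (N4 a \<cdot>\<^bsub>alg2 H\<^esub> N4 (- a)) \<cdot>\<^bsub>alg2 H\<^esub> Q" by (simp only: assoc2)
    then show ?thesis by (simp only: NN unit inv)
  qed
  have SR: "?S \<cdot>\<^bsub>alg2 H\<^esub> ?R = axis (mon_1, mon_1) 1"
  proof -
    have "?S \<cdot>\<^bsub>alg2 H\<^esub> ?R = N4 (- a) \<cdot>\<^bsub>alg2 H\<^esub> (Q \<cdot>\<^bsub>alg2 H\<^esub> Q) \<cdot>\<^bsub>alg2 H\<^esub> N4 (- (- a))"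
      by (simp only: assoc2 minus_minus)
    then show ?thesis by (simp only: NN unit inv)
  qed
  have is_inv: "is_inverse (alg2 H) ?R ?S" by (simp only: is_inverse_def RS SR one2 simp_thms)
  have inv_eq: "alg_inv (alg2 H) ?R = ?S" by (rule alg_inv_eqI[OF H2 is_inv])
  have comm: "?R \<cdot>\<^bsub>alg2 H\<^esub> coprod H u = coprod_op H u \<cdot>\<^bsub>alg2 H\<^esub> ?R" for u
  proof (induction u rule: vec_induct)
    case zero
    have "flip 0 = (0 :: 'k^(monom \<times> monom))" by (simp add: flip_def vec_eq_iff)
    then show ?case by (simp add: coprod_op_def)
  next
    case (add u v)
    have "flip (s + t) = flip s + flip t" for s t :: "'k^(monom \<times> monom)"
      by (simp add: flip_def vec_eq_iff)
    with add show ?case by (simp add: coprod_op_def)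
  next
    case (axis b c)
    have s: "flip (c *s t) = c *s flip t" for t :: "'k^(monom \<times> monom)"
      by (simp add: flip_def vec_eq_iff)
    have "N4 a \<cdot>\<^bsub>alg2 H\<^esub> A_coprod b = A_coprod b \<cdot>\<^bsub>alg2 H\<^esub> N4 a"
      unfolding H_def by (rule N4_facts)
    then have "?R \<cdot>\<^bsub>alg2 H\<^esub> A_coprod b = Q \<cdot>\<^bsub>alg2 H\<^esub> A_coprod b \<cdot>\<^bsub>alg2 H\<^esub> N4 a"
      by (simp only: assoc2)
    also have "\<dots> = flip (A_coprod b) \<cdot>\<^bsub>alg2 H\<^esub> ?R" by (simp only: flip assoc2)
    finally show ?case
      by (simp add: coprod_op_def s H_def)
  qed
  have "coprod_op H u = ?R \<cdot>\<^bsub>alg2 H\<^esub> coprod H u \<cdot>\<^bsub>alg2 H\<^esub> alg_inv (alg2 H) ?R" for u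
    by (simp only: inv_eq comm) (simp only: assoc2 RS[unfolded assoc2] unit)
  moreover have "id_coprod H ?R = leg13 H ?R \<cdot>\<^bsub>alg3 H\<^esub> leg12 H ?R"
  proof -
    have N: "id_coprod H (N4 a) = N5 mon_g a \<cdot>\<^bsub>alg3 H\<^esub> leg12 H (N4 a)" "leg13 H (N4 a) = N5 mon_1 a"
      unfolding H_def by (rule N4_facts)+
    have "id_coprod H ?R = id_coprod H Q \<cdot>\<^bsub>alg3 H\<^esub> id_coprod H (N4 a)"
      unfolding H_def by (rule A_id_coprod_mult)
    also have "\<dots> = leg13 H Q \<cdot>\<^bsub>alg3 H\<^esub> (leg12 H Q \<cdot>\<^bsub>alg3 H\<^esub> N5 mon_g a) \<cdot>\<^bsub>alg3 H\<^esub> leg12 H (N4 a)"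
      by (simp only: id_cop N assoc3)
    also have "\<dots> = leg13 H ?R \<cdot>\<^bsub>alg3 H\<^esub> leg12 H ?R"
      by (simp only: leg_mult[OF H] N N12[symmetric] assoc3)
    finally show ?thesis .
  qed
  moreover have "coprod_id H ?R = leg13 H ?R \<cdot>\<^bsub>alg3 H\<^esub> leg23 H ?R"
  proof -
    have N: "coprod_id H (N4 a) = N5 mon_g a \<cdot>\<^bsub>alg3 H\<^esub> leg23 H (N4 a)" "leg13 H (N4 a) = N5 mon_1 a"
      unfolding H_def by (rule N4_facts)+
    have "coprod_id H ?R = coprod_id H Q \<cdot>\<^bsub>alg3 H\<^esub> coprod_id H (N4 a)"
      unfolding H_def by (rule A_id_coprod_mult)
    also have "\<dots> = leg13 H Q \<cdot>\<^bsub>alg3 H\<^esub> (leg23 H Q \<cdot>\<^bsub>alg3 H\<^esub> N5 mon_g a) \<cdot>\<^bsub>alg3 H\<^esub> leg23 H (N4 a)"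
      by (simp only: cop_id N assoc3)
    also have "\<dots> = leg13 H ?R \<cdot>\<^bsub>alg3 H\<^esub> leg23 H ?R"
      by (simp only: leg_mult[OF H] N N23[symmetric] assoc3)
    finally show ?thesis .
  qed
  ultimately show ?thesis
    using is_inv unfolding quasitriangular_structure_def H_def by blast
qed

lemma R_a_quasitriangular:
  fixes a :: "'k::field"
  assumes char: "CHAR('k) \<noteq> 2" and q: "q \<in> {0, 1}"
  shows "quasitriangular_structure A_C2C2 (R_a q a)"
proof -
  define H where "H = (A_C2C2 :: (monom, 'k) hopf)"
  have two: "(2 :: 'k) \<noteq> 0"
  proof
    assume "(2 :: 'k) = 0"
    then have "of_nat 2 = (0 :: 'k)" by simp
    then have "CHAR('k) dvd 2" by (simp only: of_nat_eq_0_iff_char_dvd)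
    then have "CHAR('k) \<le> 2" "CHAR('k) \<noteq> 0" by (auto intro!: dvd_imp_le gr0I)
    moreover have "CHAR('k) \<noteq> 1" by simp
    ultimately show False using char by linarith
  qed
  then have four: "(4 :: 'k) \<noteq> 0"
    by (metis mult_2 mult_eq_0_iff numeral_Bit0)
  have H2: "is_algebra (alg2 H)" and H3: "is_algebra (alg3 H)"
    unfolding H_def by (intro tensor_algebra A_algebra)+
  have assoc2: "u \<cdot>\<^bsub>alg2 H\<^esub> v \<cdot>\<^bsub>alg2 H\<^esub> w = u \<cdot>\<^bsub>alg2 H\<^esub> (v \<cdot>\<^bsub>alg2 H\<^esub> w)" for u v w
    using H2 by (simp add: is_algebra_def)
  have assoc3: "u \<cdot>\<^bsub>alg3 H\<^esub> v \<cdot>\<^bsub>alg3 H\<^esub> w = u \<cdot>\<^bsub>alg3 H\<^esub> (v \<cdot>\<^bsub>alg3 H\<^esub> w)" for u v w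
    using H3 by (simp add: is_algebra_def)
  define E where "E u v = (1 / 2 :: 'k) *s F4 u v" for u v
  have c: "(1 / 2) * ((1 / 2) * 4) = (1 :: 'k)" "(1 / 2) * ((1 / 2) * 2) = (1 / 2 :: 'k)"
  proof -
    have t: "(1 / t) * ((1 / t) * (t * t)) = 1" if "t \<noteq> 0" for t :: 'k
      using that by simp
    have "2 * 2 = (4 :: 'k)" by simp
    with t[OF two] show "(1 / 2) * ((1 / 2) * 4) = (1 :: 'k)" by (simp only:)
    show "(1 / 2) * ((1 / 2) * 2) = (1 / 2 :: 'k)" using two by simp
  qed
  have E: "E u v \<cdot>\<^bsub>alg2 H\<^esub> E u v = axis (mon_1, mon_1) 1"
    "id_coprod H (E u v) = leg13 H (E u v) \<cdot>\<^bsub>alg3 H\<^esub> leg12 H (E u v)"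
    "coprod_id H (E u v) = leg13 H (E u v) \<cdot>\<^bsub>alg3 H\<^esub> leg23 H (E u v)" if "FP u v" for u v
  proof -
    note F = F4_facts[OF that, where 'k = 'k, folded H_def]
    show "E u v \<cdot>\<^bsub>alg2 H\<^esub> E u v = axis (mon_1, mon_1) 1"
      unfolding E_def alg_mult_simps F vec.scale_scale c vec.scale_one ..
    show "id_coprod H (E u v) = leg13 H (E u v) \<cdot>\<^bsub>alg3 H\<^esub> leg12 H (E u v)"
      unfolding E_def alg_mult_simps id_coprod_simps leg_simps F[symmetric] vec.scale_scale c ..
    show "coprod_id H (E u v) = leg13 H (E u v) \<cdot>\<^bsub>alg3 H\<^esub> leg23 H (E u v)"
      unfolding E_def alg_mult_simps coprod_id_simps leg_simps F[symmetric] vec.scale_scale c ..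
  qed
  have FP: "FP mon_g mon_g" "FP mon_g mon_h" "FP mon_h mon_gh" by (simp_all add: FP_def)
  have comm: "leg12 H (E u v) \<cdot>\<^bsub>alg3 H\<^esub> leg13 H (E u' v') = leg13 H (E u' v') \<cdot>\<^bsub>alg3 H\<^esub> leg12 H (E u v)"
    "leg23 H (E u v) \<cdot>\<^bsub>alg3 H\<^esub> leg13 H (E u' v') = leg13 H (E u' v') \<cdot>\<^bsub>alg3 H\<^esub> leg23 H (E u v)"
    if "FP u v" "FP u' v'" for u v u' v'
    using F4_comm[OF that, where 'k = 'k] by (simp_all add: E_def H_def)
  note facts = N5_F4[where 'k = 'k, folded H_def] F4_coprod[where 'k = 'k, folded H_def]
  have N5: "N5 mon_1 a \<cdot>\<^bsub>alg3 H\<^esub> leg12 H (E mon_g mon_g) = leg12 H (E mon_g mon_g) \<cdot>\<^bsub>alg3 H\<^esub> N5 mon_g a"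
    "N5 mon_1 a \<cdot>\<^bsub>alg3 H\<^esub> leg23 H (E mon_g mon_g) = leg23 H (E mon_g mon_g) \<cdot>\<^bsub>alg3 H\<^esub> N5 mon_g a"
    "N5 mon_1 a \<cdot>\<^bsub>alg3 H\<^esub> leg12 H (E mon_g mon_h) = leg12 H (E mon_g mon_h) \<cdot>\<^bsub>alg3 H\<^esub> N5 mon_h a"
    "N5 mon_h a \<cdot>\<^bsub>alg3 H\<^esub> leg12 H (E mon_h mon_gh) = leg12 H (E mon_h mon_gh) \<cdot>\<^bsub>alg3 H\<^esub> N5 mon_g a"
    "N5 mon_1 a \<cdot>\<^bsub>alg3 H\<^esub> leg23 H (E mon_g mon_h) = leg23 H (E mon_g mon_h) \<cdot>\<^bsub>alg3 H\<^esub> N5 mon_g a"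
    "N5 mon_g a \<cdot>\<^bsub>alg3 H\<^esub> leg23 H (E mon_h mon_gh) = leg23 H (E mon_h mon_gh) \<cdot>\<^bsub>alg3 H\<^esub> N5 mon_g a"
    unfolding E_def alg_mult_simps leg_simps facts by (rule refl)+
  have D: "E mon_g mon_g \<cdot>\<^bsub>alg2 H\<^esub> A_coprod b = flip (A_coprod b) \<cdot>\<^bsub>alg2 H\<^esub> E mon_g mon_g"
    "E mon_g mon_h \<cdot>\<^bsub>alg2 H\<^esub> T4 b = flip (A_coprod b) \<cdot>\<^bsub>alg2 H\<^esub> E mon_g mon_h"
    "E mon_h mon_gh \<cdot>\<^bsub>alg2 H\<^esub> A_coprod b = T4 b \<cdot>\<^bsub>alg2 H\<^esub> E mon_h mon_gh" for b
    unfolding E_def alg_mult_simps facts by (rule refl)+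
  have R_a_N4: "R_a q a = R_q q \<cdot>\<^bsub>alg2 A_C2C2\<^esub> N4 a" for q
    by (simp add: R_a_def N4_def gen_x_def gen_g_def)
  show ?thesis
  proof (cases "q = 0")
    case True
    have "R_q 0 = E mon_g mon_g" unfolding E_def by (rule R_q_F4[OF two])
    then show ?thesis
      unfolding R_a_N4 True
      using quasitriangular_from_R_q[where 'k = 'k, folded H_def, OF E[OF FP(1)] D(1) N5(1,2)]
      by (simp only: H_def)
  next
    case False
    with q have q: "q = Suc 0" by simp
    let ?E = "E mon_g mon_h" and ?F = "E mon_h mon_gh"
    let ?Q = "?E \<cdot>\<^bsub>alg2 H\<^esub> ?F"
    have 4: "(1 / 2) * (1 / 2) = (1 / 4 :: 'k)" by simp
    have Q: "R_q (Suc 0) = ?Q"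
      unfolding E_def alg_mult_simps vec.scale_scale 4 H_def by (rule R_q_F4[OF two])
    note leg = leg_mult[of H, OF A_algebra[where 'k = 'k, folded H_def]]
    have cop: "id_coprod H (s \<cdot>\<^bsub>alg2 H\<^esub> t) = id_coprod H s \<cdot>\<^bsub>alg3 H\<^esub> id_coprod H t"
      "coprod_id H (s \<cdot>\<^bsub>alg2 H\<^esub> t) = coprod_id H s \<cdot>\<^bsub>alg3 H\<^esub> coprod_id H t" for s t
      unfolding H_def by (rule A_id_coprod_mult)+
    have EF: "?E \<cdot>\<^bsub>alg2 H\<^esub> ?F = ?F \<cdot>\<^bsub>alg2 H\<^esub> ?E"
      by (simp add: E_def F4_def H_def algebra_simps)
    have l: "w \<cdot>\<^bsub>alg3 H\<^esub> (y \<cdot>\<^bsub>alg3 H\<^esub> z) = y \<cdot>\<^bsub>alg3 H\<^esub> (w \<cdot>\<^bsub>alg3 H\<^esub> z)"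
      if "w \<cdot>\<^bsub>alg3 H\<^esub> y = y \<cdot>\<^bsub>alg3 H\<^esub> w" for w y z
      using that by (metis assoc3)
    have "quasitriangular_structure H (?Q \<cdot>\<^bsub>alg2 H\<^esub> N4 a)"
    proof (rule quasitriangular_from_R_q[where 'k = 'k, folded H_def])
      have "?Q \<cdot>\<^bsub>alg2 H\<^esub> ?Q = (?E \<cdot>\<^bsub>alg2 H\<^esub> ?F) \<cdot>\<^bsub>alg2 H\<^esub> (?F \<cdot>\<^bsub>alg2 H\<^esub> ?E)" by (simp only: EF)
      also have "\<dots> = ?E \<cdot>\<^bsub>alg2 H\<^esub> (?F \<cdot>\<^bsub>alg2 H\<^esub> ?F) \<cdot>\<^bsub>alg2 H\<^esub> ?E" by (simp only: assoc2)
      also have "\<dots> = axis (mon_1, mon_1) 1"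
      proof -
        have "?E \<cdot>\<^bsub>alg2 H\<^esub> axis (mon_1, mon_1) 1 = ?E"
          using H2 by (simp add: is_algebra_def H_def)
        then show ?thesis by (simp only: E FP)
      qed
      finally show "?Q \<cdot>\<^bsub>alg2 H\<^esub> ?Q = axis (mon_1, mon_1) 1" .
      show "id_coprod H ?Q = leg13 H ?Q \<cdot>\<^bsub>alg3 H\<^esub> leg12 H ?Q"
        by (simp only: cop leg E FP assoc3 l[OF comm(1)[OF FP(2,3)]])
      show "coprod_id H ?Q = leg13 H ?Q \<cdot>\<^bsub>alg3 H\<^esub> leg23 H ?Q"
        by (simp only: cop leg E FP assoc3 l[OF comm(2)[OF FP(2,3)]])
      show "?Q \<cdot>\<^bsub>alg2 H\<^esub> A_coprod b = flip (A_coprod b) \<cdot>\<^bsub>alg2 H\<^esub> ?Q" for b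
        by (simp only: assoc2 D) (simp only: assoc2[symmetric] D)
      show "N5 mon_1 a \<cdot>\<^bsub>alg3 H\<^esub> leg12 H ?Q = leg12 H ?Q \<cdot>\<^bsub>alg3 H\<^esub> N5 mon_g a"
        by (simp only: leg assoc3[symmetric] N5) (simp only: assoc3 N5)
      show "N5 mon_1 a \<cdot>\<^bsub>alg3 H\<^esub> leg23 H ?Q = leg23 H ?Q \<cdot>\<^bsub>alg3 H\<^esub> N5 mon_g a"
        by (simp only: leg assoc3[symmetric] N5) (simp only: assoc3 N5)
    qed
    then show ?thesis
      unfolding R_a_N4 q Q unfolding H_def .
  qed
qed

end

theory Submission
  imports Defs
begin

text \<open>
  The projection of \<open>A\<close> onto the group algebra of \<open>C\<^sub>2 \<times> C\<^sub>2\<close> that kills \<open>x\<close> is an algebra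
  homomorphism with commutative image, so applying it to some of the tensor legs controls the
  conjugate of \<open>X\<^sub>1\<^sub>3\<close> by \<open>R\<close> without using the shape of \<open>R\<close>.  On all three legs, the conjugation
  disappears and the first coproduct axiom kills the part of \<open>X\<close> of degree \<open>(0, 0)\<close> in \<open>x\<close>;
  commutation with \<open>g \<otimes> g\<close> kills the degrees \<open>(0, 1)\<close> and \<open>(1, 0)\<close>.  For the remaining
  \<open>X = \<Sum> d\<^sub>u\<^sub>v ux \<otimes> vx\<close>, projecting the third (first) leg kills the conjugate altogether, and comparing
  \<open>\<Delta>(vx) = v \<otimes> vx + vx \<otimes> vg\<close> (\<open>\<Delta>(ux)\<close>) with \<open>X\<^sub>1\<^sub>2\<close> (\<open>X\<^sub>2\<^sub>3\<close>) forces \<open>v = g\<close> (\<open>u = 1\<close>).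
  Conversely \<open>x \<otimes> gx\<close> is a solution because \<open>R (x \<otimes> g) = (x \<otimes> 1) R\<close> and \<open>R (g \<otimes> gx) = (1 \<otimes> gx) R\<close>.
\<close>

section \<open>Coordinate projections that are algebra homomorphisms\<close>

definition coord_proj :: "('b \<Rightarrow> bool) \<Rightarrow> ('k::field)^('b::finite) \<Rightarrow> 'k^'b" where
  "coord_proj P u = (\<chi> b. if P b then u $ b else 0)"

text \<open>In other words, the basis vectors in \<open>P\<close> span a subalgebra and the others
  span a two-sided ideal complementary to it.\<close>

definition multiplicative_pred ::
    "('b::finite, 'k::field, 'm) alg_scheme \<Rightarrow> ('b \<Rightarrow> bool) \<Rightarrow> bool" where
  "multiplicative_pred H P \<longleftrightarrow>
    (\<forall>b c. coord_proj P (prod_basis H b c) = (if P b \<and> P c then prod_basis H b c else 0))"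

lemma coord_proj_nth [simp]: "coord_proj P u $ b = (if P b then u $ b else 0)"
  by (simp add: coord_proj_def)

lemma coord_proj_simps [simp]:
  "coord_proj P 0 = 0" "coord_proj P (u + v) = coord_proj P u + coord_proj P v"
  "coord_proj P (c *s u) = c *s coord_proj P u"
  "coord_proj P (axis b 1) = (if P b then axis b 1 else 0)"
  "coord_proj (\<lambda>_. True) u = u"
  by (auto simp: vec_eq_iff axis_def)

lemma coord_proj_tensor:
  "coord_proj (\<lambda>(b, c). P b \<and> Q c) (u \<otimes> v) = coord_proj P u \<otimes> coord_proj Q v"
  by (auto simp: vec_eq_iff tensor_def)

lemma coord_proj_mult:
  assumes "multiplicative_pred H P"
  shows "coord_proj P (u \<cdot>\<^bsub>H\<^esub> v) = coord_proj P u \<cdot>\<^bsub>H\<^esub> coord_proj P v"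
  by (rule vec_bilinear_eqI[where f = "\<lambda>u v. coord_proj P (u \<cdot>\<^bsub>H\<^esub> v)"])
    (use assms in \<open>auto simp: multiplicative_pred_def\<close>)

lemma multiplicative_pred_True: "multiplicative_pred H (\<lambda>_. True)"
  by (simp add: multiplicative_pred_def)

lemma multiplicative_pred_tensor:
  assumes "multiplicative_pred H P" "multiplicative_pred K Q"
  shows "multiplicative_pred (tensor_alg H K) (\<lambda>(b, c). P b \<and> Q c)"
  using assms by (auto simp: multiplicative_pred_def coord_proj_tensor)

text \<open>On pure tensors the projected product splits into one factor per leg, so commutativity
  modulo the kernel can be checked leg by leg.\<close>

lemma coord_proj_comm_tensor:
  fixes H :: "('b::finite, 'k::field, 'm) alg_scheme" and K :: "('c::finite, 'k, 'n) alg_scheme"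
  assumes H: "\<And>s t. coord_proj P (s \<cdot>\<^bsub>H\<^esub> t) = coord_proj P (t \<cdot>\<^bsub>H\<^esub> s)"
    and K: "\<And>s t. coord_proj Q (s \<cdot>\<^bsub>K\<^esub> t) = coord_proj Q (t \<cdot>\<^bsub>K\<^esub> s)"
  shows "coord_proj (\<lambda>(b, c). P b \<and> Q c) (s \<cdot>\<^bsub>tensor_alg H K\<^esub> t) =
    coord_proj (\<lambda>(b, c). P b \<and> Q c) (t \<cdot>\<^bsub>tensor_alg H K\<^esub> s)"
proof (rule vec_bilinear_eqI[where f = "\<lambda>s t. coord_proj (\<lambda>(b, c). P b \<and> Q c) (s \<cdot>\<^bsub>tensor_alg H K\<^esub> t)"])
  fix p q :: "'b \<times> 'c"
  obtain a b c d where pq: "p = (a, b)" "q = (c, d)" by (metis surj_pair)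
  have ax: "axis (a, b) (1 :: 'k) = axis a 1 \<otimes> axis b 1" for a :: 'b and b :: 'c by simp
  show "coord_proj (\<lambda>(b, c). P b \<and> Q c) (axis p 1 \<cdot>\<^bsub>tensor_alg H K\<^esub> axis q 1) =
      coord_proj (\<lambda>(b, c). P b \<and> Q c) (axis q 1 \<cdot>\<^bsub>tensor_alg H K\<^esub> axis p 1)"
    unfolding pq ax tensor_mult coord_proj_tensor
    by (simp only: H[of "axis a 1"] K[of "axis b 1"])
qed simp_all

section \<open>Conjugation by tensor legs\<close>

lemma leg12_conv: "leg12 H t = assoc_tensor (t \<otimes> \<one>\<^bsub>H\<^esub>)"
  by (simp add: leg12_def assoc_tensor_def tensor_def vec_eq_iff)

lemma leg23_conv: "leg23 H t = \<one>\<^bsub>H\<^esub> \<otimes> t"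
  by (simp add: leg23_def tensor_def vec_eq_iff)

text \<open>The passive leg is only multiplied by the unit, so a product in three legs reduces to
  one in two.\<close>

lemma leg_mult_tensor:
  assumes "is_algebra H"
  shows "leg12 H t \<cdot>\<^bsub>alg3 H\<^esub> assoc_tensor (s \<otimes> u) = assoc_tensor ((t \<cdot>\<^bsub>alg2 H\<^esub> s) \<otimes> u)"
    "assoc_tensor (s \<otimes> u) \<cdot>\<^bsub>alg3 H\<^esub> leg12 H t = assoc_tensor ((s \<cdot>\<^bsub>alg2 H\<^esub> t) \<otimes> u)"
    "leg23 H t \<cdot>\<^bsub>alg3 H\<^esub> (u \<otimes> s) = u \<otimes> (t \<cdot>\<^bsub>alg2 H\<^esub> s)"
    "(u \<otimes> s) \<cdot>\<^bsub>alg3 H\<^esub> leg23 H t = u \<otimes> (s \<cdot>\<^bsub>alg2 H\<^esub> t)"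
  using assms
  by (simp_all add: leg12_conv leg23_conv tensor_mult is_algebra_def flip: assoc_tensor_mult)

lemma leg_is_inverse:
  assumes "is_algebra H" "is_inverse (alg2 H) R S"
  shows "is_inverse (alg3 H) (leg12 H R) (leg12 H S)"
    "is_inverse (alg3 H) (leg23 H R) (leg23 H S)"
  using assms(2)
  by (simp_all add: is_inverse_def flip: leg_mult[OF assms(1)])
    (simp_all add: leg_tensor)

text \<open>Trades a conjugation for an intertwining relation, so that the inverse never has to be
  computed.\<close>

lemma conjugate_eqI:
  assumes "is_algebra H" "is_inverse H u v" "u \<cdot>\<^bsub>H\<^esub> w = z \<cdot>\<^bsub>H\<^esub> u"
  shows "alg_inv H u \<cdot>\<^bsub>H\<^esub> z \<cdot>\<^bsub>H\<^esub> u = w"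
  unfolding alg_inv_eqI[OF assms(1,2)] using assms
  by (metis is_algebra_def is_inverse_def)

lemma coord_proj_conjugate:
  assumes "is_algebra H" "is_inverse H u v" and P: "multiplicative_pred H P"
    and comm: "\<And>s t. coord_proj P (s \<cdot>\<^bsub>H\<^esub> t) = coord_proj P (t \<cdot>\<^bsub>H\<^esub> s)"
  shows "coord_proj P (alg_inv H u \<cdot>\<^bsub>H\<^esub> z \<cdot>\<^bsub>H\<^esub> u) = coord_proj P z"
proof -
  \<comment> \<open>Under the projection \<open>u\<close> may be moved cyclically to the front,
    where it cancels its inverse \<open>v\<close>.\<close>
  have "coord_proj P (v \<cdot>\<^bsub>H\<^esub> z \<cdot>\<^bsub>H\<^esub> u) = coord_proj P (u \<cdot>\<^bsub>H\<^esub> (v \<cdot>\<^bsub>H\<^esub> z))"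
    by (rule comm)
  also have "u \<cdot>\<^bsub>H\<^esub> (v \<cdot>\<^bsub>H\<^esub> z) = z"
    using assms(1,2) by (metis is_algebra_def is_inverse_def)
  finally show ?thesis by (simp add: alg_inv_eqI[OF assms(1,2)])
qed

lemma coord_proj_conjugate_zero:
  assumes "multiplicative_pred H P" "coord_proj P z = 0"
  shows "coord_proj P (v \<cdot>\<^bsub>H\<^esub> z \<cdot>\<^bsub>H\<^esub> u) = 0"
  using assms by (simp add: coord_proj_mult)

section \<open>Coordinates in the Hopf algebra\<close>

lemma axis_nth_if: "axis b y $ c = (if c = b then y else 0)"
  by (simp add: axis_def)

lemma tensor_nth: "(u \<otimes> v) $ (b, c) = u $ b * v $ c"
  by (simp add: tensor_def)

definition x_free :: "monom \<Rightarrow> bool" where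
  "x_free b \<longleftrightarrow> \<not> snd (snd b)"

lemma x_free_simp [simp]: "x_free (i, j, k) \<longleftrightarrow> \<not> k"
  by (simp add: x_free_def)

text \<open>Multiplying monomials never lowers the degree in \<open>x\<close>, so a product is free
  of \<open>x\<close> only if both factors are.\<close>

lemma multiplicative_pred_x_free: "multiplicative_pred A_C2C2 x_free"
  by (auto simp: multiplicative_pred_def vec_eq_iff axis_def)

text \<open>Signs arise only from moving \<open>x\<close> past \<open>g\<close> or \<open>h\<close>,
  and any product containing \<open>x\<close> projects to 0 in either order.\<close>

lemma coord_proj_x_free_comm:
  "coord_proj x_free (s \<cdot>\<^bsub>A_C2C2\<^esub> t) = coord_proj x_free (t \<cdot>\<^bsub>A_C2C2\<^esub> (s :: ('k::field)^monom))"
proof -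
  have ax: "coord_proj x_free (axis b 1 \<cdot>\<^bsub>A_C2C2\<^esub> axis c (1 :: 'k)) =
      coord_proj x_free (axis c 1 \<cdot>\<^bsub>A_C2C2\<^esub> axis b 1)" for b c
    by (cases b; cases c) (auto simp: vec_eq_iff axis_nth_if)
  show ?thesis
    by (rule vec_bilinear_eqI[where f = "\<lambda>s t. coord_proj x_free (s \<cdot>\<^bsub>A_C2C2\<^esub> t)"])
      (simp_all only: ax alg_mult_simps(1-8) coord_proj_simps)
qed

lemma A_coprod_conv:
  "A_coprod (i, j, k) = (if k
    then axis ((i, j, False), (i, j, True)) 1 + axis ((i, j, True), (\<not> i, j, False)) 1
    else axis ((i, j, False), (i, j, False)) (1 :: 'k::field))"
  by (cases i; cases j; cases k; simp add: gen_g_def gen_h_def gen_x_def)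

text \<open>Prescribing which leg contains \<open>x\<close> selects a single summand of the
  coproduct: \<open>vx \<otimes> vg\<close> or \<open>v \<otimes> v\<close> when the last leg is
  free of \<open>x\<close>, and \<open>u \<otimes> ux\<close> when only the second of the first two
  legs contains it.\<close>

lemma coprod_nth:
  fixes X :: "('k::field)^(monom \<times> monom)"
  shows
  "id_coprod A_C2C2 X $ (p, (i, j, k), (i', j', False)) =
    (if (i' \<longleftrightarrow> (i \<noteq> k)) \<and> (j' \<longleftrightarrow> j) then X $ (p, (i, j, k)) else 0)"
  "coprod_id A_C2C2 X $ ((i', j', False), (i, j, True), p) =
    (if i' = i \<and> j' = j then X $ ((i, j, True), p) else 0)"
proof -
  show "id_coprod A_C2C2 X $ (p, (i, j, k), (i', j', False)) =
    (if (i' \<longleftrightarrow> (i \<noteq> k)) \<and> (j' \<longleftrightarrow> j) then X $ (p, (i, j, k)) else 0)"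
  proof (induction X rule: vec_induct)
    case (axis b c)
    obtain q i0 j0 k0 where b: "b = (q, (i0, j0, k0))" by (metis surj_pair)
    then show ?case
      by (cases k0)
        (auto simp: A_coprod_conv axis_nth_if simp del: A_coprod.simps)
  qed auto
  show "coprod_id A_C2C2 X $ ((i', j', False), (i, j, True), p) =
    (if i' = i \<and> j' = j then X $ ((i, j, True), p) else 0)"
  proof (induction X rule: vec_induct)
    case (axis b c)
    obtain i0 j0 k0 q where b: "b = ((i0, j0, k0), q)" by (metis surj_pair)
    then show ?case
      by (cases k0)
        (auto simp: A_coprod_conv axis_nth_if simp del: A_coprod.simps)
  qed auto
qed

text \<open>The sign comes from moving \<open>x\<close> past \<open>g\<close> in each leg, which
  happens only for multiplication from the right.\<close>

lemma mult_gg_nth: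
  fixes X :: "('k::field)^(monom \<times> monom)"
  shows
  "(X \<cdot>\<^bsub>alg2 A_C2C2\<^esub> axis (mon_g, mon_g) 1) $ ((\<not> i, j, k), (\<not> i', j', k')) =
    (if k = k' then 1 else -1) * X $ ((i, j, k), (i', j', k'))"
  "(axis (mon_g, mon_g) 1 \<cdot>\<^bsub>alg2 A_C2C2\<^esub> X) $ ((\<not> i, j, k), (\<not> i', j', k')) =
    X $ ((i, j, k), (i', j', k'))"
proof -
  show "(X \<cdot>\<^bsub>alg2 A_C2C2\<^esub> axis (mon_g, mon_g) 1) $ ((\<not> i, j, k), (\<not> i', j', k')) =
    (if k = k' then 1 else -1) * X $ ((i, j, k), (i', j', k'))"
  proof (induction X rule: vec_induct)
    case (axis b c)
    then show ?case by (cases b) (auto simp: tensor_nth axis_nth_if split: if_splits)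
  qed (auto simp: algebra_simps)
  show "(axis (mon_g, mon_g) 1 \<cdot>\<^bsub>alg2 A_C2C2\<^esub> X) $ ((\<not> i, j, k), (\<not> i', j', k')) =
    X $ ((i, j, k), (i', j', k'))"
  proof (induction X rule: vec_induct)
    case (axis b c)
    then show ?case by (cases b) (auto simp: tensor_nth axis_nth_if split: if_splits)
  qed auto
qed

section \<open>Infinitesimal R-matrices\<close>

lemma field_two_neq_zero:
  assumes "CHAR('k::field) \<noteq> 2"
  shows "(2 :: 'k) \<noteq> 0"
proof
  assume "(2 :: 'k) = 0"
  then have "of_nat 2 = (0 :: 'k)" by simp
  then have "CHAR('k) dvd 2" by (simp only: of_nat_eq_0_iff_char_dvd)
  then have "CHAR('k) \<le> 2" "CHAR('k) \<noteq> 0" by (auto intro!: dvd_imp_le gr0I)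
  moreover have "CHAR('k) \<noteq> 1" by simp
  ultimately show False using assms by linarith
qed

lemma infinitesimal_R_matrix_imp_multiple:
  fixes X R :: "('k::field)^(monom \<times> monom)"
  defines "H \<equiv> A_C2C2"
  assumes two: "(2 :: 'k) \<noteq> 0" and R: "is_inverse (alg2 H) R S"
    and X: "infinitesimal_R_matrix H R X"
  shows "X = X $ (mon_x, mon_gx) *s axis (mon_x, mon_gx) 1"
proof -
  have H: "is_algebra H" unfolding H_def by (rule A_algebra)
  have H3: "is_algebra (alg3 H)" by (intro tensor_algebra H)
  note inv = leg_is_inverse[OF H R]
  note x_free = multiplicative_pred_x_free[where 'a = 'k, folded H_def]
  note coprod_nth = coprod_nth[where X = X, folded H_def]
  let ?Y12 = "alg_inv (alg3 H) (leg12 H R) \<cdot>\<^bsub>alg3 H\<^esub> leg13 H X \<cdot>\<^bsub>alg3 H\<^esub> leg12 H R"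
  let ?Y23 = "alg_inv (alg3 H) (leg23 H R) \<cdot>\<^bsub>alg3 H\<^esub> leg13 H X \<cdot>\<^bsub>alg3 H\<^esub> leg23 H R"
  have X12: "id_coprod H X = leg12 H X + ?Y12" and X23: "coprod_id H X = leg23 H X + ?Y23"
    and Xg: "X \<cdot>\<^bsub>alg2 H\<^esub> axis (mon_g, mon_g) 1 = axis (mon_g, mon_g) 1 \<cdot>\<^bsub>alg2 H\<^esub> X"
  proof -
    have "coprod H (axis mon_g 1) = axis (mon_g, mon_g) 1"
      by (simp add: H_def A_coprod_conv del: A_coprod.simps)
    then show "X \<cdot>\<^bsub>alg2 H\<^esub> axis (mon_g, mon_g) 1 = axis (mon_g, mon_g) 1 \<cdot>\<^bsub>alg2 H\<^esub> X"
      using X unfolding infinitesimal_R_matrix_def by metis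
  qed (use X in \<open>simp_all add: infinitesimal_R_matrix_def\<close>)
  have unit: "\<one>\<^bsub>H\<^esub> $ (i, j, k) = (if \<not> i \<and> \<not> j \<and> \<not> k then 1 else 0)" for i j k
    by (auto simp: H_def axis_def)

  have free: "X $ ((i, j, False), (i', j', False)) = 0" for i j i' j'
  proof -
    define P where "P = (\<lambda>(b, c). x_free b \<and> (case c of (c, d) \<Rightarrow> x_free c \<and> x_free d))"
    have "multiplicative_pred (alg3 H) P"
      unfolding P_def by (intro multiplicative_pred_tensor x_free)
    then have "coord_proj P ?Y12 = coord_proj P (leg13 H X)"
      unfolding P_def
      by (intro coord_proj_conjugate[OF H3 inv(1)] coord_proj_comm_tensor)
        (simp_all only: H_def coord_proj_x_free_comm)
    then have "coord_proj P (id_coprod H X) = coord_proj P (leg12 H X + leg13 H X)"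
      by (simp add: X12)
    \<comment> \<open>Compare coefficients at third leg 1. If the second leg is not 1, neither the
      coproduct nor \<open>leg13 H X\<close> contributes, so the coefficient is 0. If it is 1, all
      three terms are equal and the coefficient equals its own double.\<close>
    then have "coord_proj P (id_coprod H X) $ ((i, j, False), (i', j', False), mon_1) =
        coord_proj P (leg12 H X + leg13 H X) $ ((i, j, False), (i', j', False), mon_1)"
      by (rule arg_cong)
    moreover have "(2 :: 'k) \<noteq> 1" by (metis add_cancel_right_right one_add_one zero_neq_one)
    ultimately show ?thesis
      by (cases i'; cases j') (simp_all add: P_def coprod_nth leg12_def leg13_def unit)
  qed
  have mixed: "X $ ((i, j, k), (i', j', k')) = 0" if "k \<noteq> k'" for i j k i' j' k'
  proof -
    have "- X $ ((i, j, k), (i', j', k')) = X $ ((i, j, k), (i', j', k'))"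
      using arg_cong[OF Xg, of "\<lambda>Y. Y $ ((\<not> i, j, k), (\<not> i', j', k'))"] that
      by (simp only: H_def mult_gg_nth) simp
    then have "2 * X $ ((i, j, k), (i', j', k')) = 0"
      by (metis mult_2 neg_eq_iff_add_eq_0)
    with two show ?thesis by simp
  qed
  have snd_free: "X $ (p, (i, j, False)) = 0" for p i j
    using free[of _ _ i j] mixed[of _ False _ _ i j] by (cases p; cases "snd (snd p)") auto
  have fst_free: "X $ ((i, j, False), p) = 0" for p i j
    using free[of i j] mixed[of False _ i j] by (cases p; cases "snd (snd p)") auto
  have snd_gx: "X $ (p, (i, j, True)) = 0" if "(i, j) \<noteq> (True, False)" for p i j
  proof -
    \<comment> \<open>The conjuncts \<open>True\<close> stand for the identity on the first two
      legs, in the shape that \<open>multiplicative_pred_tensor\<close> produces.\<close>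
    define P :: "monom \<times> monom \<times> monom \<Rightarrow> bool"
      where "P = (\<lambda>(b, c). True \<and> (case c of (c, d) \<Rightarrow> True \<and> x_free d))"
    have P: "multiplicative_pred (alg3 H) P"
      unfolding P_def by (intro multiplicative_pred_tensor multiplicative_pred_True x_free)
    have "coord_proj P (leg13 H X) = 0"
      by (auto simp: vec_eq_iff P_def leg13_def snd_free)
    then have "coord_proj P (id_coprod H X) = coord_proj P (leg12 H X)"
      by (simp add: X12 coord_proj_conjugate_zero[OF P])
    \<comment> \<open>With \<open>v\<close> for the group element of exponents
      \<open>(i, j)\<close>, this is the coordinate of \<open>vx \<otimes> vg\<close>. Since
      \<open>leg12 H X\<close> has third leg 1, it can contribute only if
      \<open>v = g\<close>.\<close>
    then have "coord_proj P (id_coprod H X) $ (p, (i, j, True), (\<not> i, j, False)) =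
        coord_proj P (leg12 H X) $ (p, (i, j, True), (\<not> i, j, False))"
      by simp
    with that show ?thesis by (simp add: P_def coprod_nth leg12_def unit split: if_splits)
  qed
  have fst_x: "X $ ((i, j, True), p) = 0" if "(i, j) \<noteq> (False, False)" for p i j
  proof -
    define P :: "monom \<times> monom \<times> monom \<Rightarrow> bool" where "P = (\<lambda>(b, c). x_free b \<and> True)"
    have P: "multiplicative_pred (alg3 H) P"
      unfolding P_def by (intro multiplicative_pred_tensor multiplicative_pred_True x_free)
    have "coord_proj P (leg13 H X) = 0"
      by (auto simp: vec_eq_iff P_def leg13_def fst_free)
    then have "coord_proj P (coprod_id H X) = coord_proj P (leg23 H X)"
      by (simp add: X23 coord_proj_conjugate_zero[OF P])
    \<comment> \<open>This is the coordinate of \<open>u \<otimes> ux\<close>, to which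
      \<open>leg23 H X\<close> can contribute only if \<open>u = 1\<close>.\<close>
    then have "coord_proj P (coprod_id H X) $ ((i, j, False), (i, j, True), p) =
        coord_proj P (leg23 H X) $ ((i, j, False), (i, j, True), p)"
      by simp
    with that show ?thesis by (simp add: P_def coprod_nth leg23_def unit split: if_splits)
  qed
  have "X $ ((i, j, k), (i', j', k')) = 0"
    if "((i, j, k), (i', j', k')) \<noteq> (mon_x, mon_gx)" for i j k i' j' k'
    using that snd_free fst_free snd_gx fst_x by (cases k; cases k') auto
  then show ?thesis
    by (auto simp: vec_eq_iff axis_def)
qed

text \<open>Both conjugates equal \<open>x \<otimes> g \<otimes> gx\<close>. This is also what
  remains of \<open>x \<otimes> \<Delta>(gx)\<close> after removing
  \<open>x \<otimes> gx \<otimes> 1\<close>, and of \<open>\<Delta>(x) \<otimes> gx\<close> after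
  removing \<open>1 \<otimes> x \<otimes> gx\<close>.\<close>

lemma infinitesimal_R_matrix_multiple:
  fixes R :: "('k::field)^(monom \<times> monom)"
  defines "H \<equiv> A_C2C2"
  assumes R: "is_inverse (alg2 H) R S"
    and Rx: "R \<cdot>\<^bsub>alg2 H\<^esub> axis (mon_x, mon_g) 1 = axis (mon_x, mon_1) 1 \<cdot>\<^bsub>alg2 H\<^esub> R"
    and Rgx: "R \<cdot>\<^bsub>alg2 H\<^esub> axis (mon_g, mon_gx) 1 = axis (mon_1, mon_gx) 1 \<cdot>\<^bsub>alg2 H\<^esub> R"
  shows "infinitesimal_R_matrix H R (c *s axis (mon_x, mon_gx) 1)"
proof -
  have H: "is_algebra H" unfolding H_def by (rule A_algebra)
  have H3: "is_algebra (alg3 H)" by (intro tensor_algebra H)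
  note inv = leg_is_inverse[OF H R]
  let ?X = "axis (mon_x, mon_gx) (1 :: 'k)" and ?w = "axis (mon_x, mon_g, mon_gx) (1 :: 'k)"
  have "?X \<cdot>\<^bsub>alg2 H\<^esub> coprod H u = coprod H u \<cdot>\<^bsub>alg2 H\<^esub> ?X" for u
  proof (induction u rule: vec_induct)
    case (axis b c)
    obtain i j k where "b = (i, j, k)" by (metis surj_pair)
    then show ?case
      by (cases i; cases j; cases k)
        (simp_all add: H_def A_coprod_conv algebra_simps del: A_coprod.simps)
  qed simp_all
  moreover have "alg_inv (alg3 H) (leg12 H R) \<cdot>\<^bsub>alg3 H\<^esub> leg13 H ?X \<cdot>\<^bsub>alg3 H\<^esub> leg12 H R = ?w"
  proof (rule conjugate_eqI[OF H3 inv(1)])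
    have "?w = assoc_tensor (axis (mon_x, mon_g) 1 \<otimes> axis mon_gx 1)"
      "leg13 H ?X = assoc_tensor (axis (mon_x, mon_1) 1 \<otimes> axis mon_gx 1)"
      by (simp_all add: H_def)
    then show "leg12 H R \<cdot>\<^bsub>alg3 H\<^esub> ?w = leg13 H ?X \<cdot>\<^bsub>alg3 H\<^esub> leg12 H R"
      by (simp only: leg_mult_tensor[OF H] Rx)
  qed
  moreover have "alg_inv (alg3 H) (leg23 H R) \<cdot>\<^bsub>alg3 H\<^esub> leg13 H ?X \<cdot>\<^bsub>alg3 H\<^esub> leg23 H R = ?w"
  proof (rule conjugate_eqI[OF H3 inv(2)])
    have "?w = axis mon_x 1 \<otimes> axis (mon_g, mon_gx) 1"
      "leg13 H ?X = axis mon_x 1 \<otimes> axis (mon_1, mon_gx) 1"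
      by (simp_all add: H_def)
    then show "leg23 H R \<cdot>\<^bsub>alg3 H\<^esub> ?w = leg13 H ?X \<cdot>\<^bsub>alg3 H\<^esub> leg23 H R"
      by (simp only: leg_mult_tensor[OF H] Rgx)
  qed
  moreover have "id_coprod H ?X = leg12 H ?X + ?w" "coprod_id H ?X = leg23 H ?X + ?w"
    by (simp_all add: H_def A_coprod_conv del: A_coprod.simps)
  ultimately show ?thesis
    unfolding infinitesimal_R_matrix_def
    by (simp add: vec.scale_right_distrib del: leg_axis id_coprod_simps(5) coprod_id_simps(5))
qed

text \<open>The relations are checked on the factors of \<open>R_a\<close>. For \<open>q = 1\<close>
  the factor \<open>F4 h gh\<close> first turns \<open>x \<otimes> g\<close> into
  \<open>x \<otimes> h\<close>, which \<open>F4 g h\<close> turns into \<open>x \<otimes> 1\<close>.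
  The factor \<open>N4 a\<close> commutes with both elements because \<open>x\<close> squares to
  0.\<close>

lemma R_a_skew_comm:
  fixes a :: "'k::field"
  defines "H \<equiv> A_C2C2"
  assumes two: "(2 :: 'k) \<noteq> 0" and q: "q \<in> {0, 1}"
  shows "R_a q a \<cdot>\<^bsub>alg2 H\<^esub> axis (mon_x, mon_g) 1 = axis (mon_x, mon_1) 1 \<cdot>\<^bsub>alg2 H\<^esub> R_a q a"
    "R_a q a \<cdot>\<^bsub>alg2 H\<^esub> axis (mon_g, mon_gx) 1 = axis (mon_1, mon_gx) 1 \<cdot>\<^bsub>alg2 H\<^esub> R_a q a"
proof -
  have H2: "is_algebra (alg2 H)"
    unfolding H_def by (intro tensor_algebra A_algebra)
  have assoc: "u \<cdot>\<^bsub>alg2 H\<^esub> v \<cdot>\<^bsub>alg2 H\<^esub> w = u \<cdot>\<^bsub>alg2 H\<^esub> (v \<cdot>\<^bsub>alg2 H\<^esub> w)" for u v w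
    using H2 by (simp add: is_algebra_def)
  have R_a: "R_a q a = R_q q \<cdot>\<^bsub>alg2 H\<^esub> N4 a"
    by (simp add: R_a_def N4_def gen_x_def gen_g_def H_def)
  let ?F = "\<lambda>u v. F4 u v :: 'k^(monom \<times> monom)"
  have F4:
    "?F mon_g mon_g \<cdot>\<^bsub>alg2 H\<^esub> axis (mon_x, mon_g) 1 = axis (mon_x, mon_1) 1 \<cdot>\<^bsub>alg2 H\<^esub> ?F mon_g mon_g"
    "?F mon_g mon_g \<cdot>\<^bsub>alg2 H\<^esub> axis (mon_g, mon_gx) 1 = axis (mon_1, mon_gx) 1 \<cdot>\<^bsub>alg2 H\<^esub> ?F mon_g mon_g"
    "?F mon_g mon_h \<cdot>\<^bsub>alg2 H\<^esub> axis (mon_x, mon_h) 1 = axis (mon_x, mon_1) 1 \<cdot>\<^bsub>alg2 H\<^esub> ?F mon_g mon_h"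
    "?F mon_h mon_gh \<cdot>\<^bsub>alg2 H\<^esub> axis (mon_x, mon_g) 1 = axis (mon_x, mon_h) 1 \<cdot>\<^bsub>alg2 H\<^esub> ?F mon_h mon_gh"
    "?F mon_g mon_h \<cdot>\<^bsub>alg2 H\<^esub> axis (mon_g, mon_gx) 1 = axis (mon_1, mon_gx) 1 \<cdot>\<^bsub>alg2 H\<^esub> ?F mon_g mon_h"
    "?F mon_h mon_gh \<cdot>\<^bsub>alg2 H\<^esub> axis (mon_g, mon_gx) 1 = axis (mon_g, mon_gx) 1 \<cdot>\<^bsub>alg2 H\<^esub> ?F mon_h mon_gh"
    by (simp_all add: F4_def H_def algebra_simps)
  have N4: "N4 a \<cdot>\<^bsub>alg2 H\<^esub> axis (mon_x, mon_g) 1 = axis (mon_x, mon_g) 1 \<cdot>\<^bsub>alg2 H\<^esub> N4 a"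
    "N4 a \<cdot>\<^bsub>alg2 H\<^esub> axis (mon_g, mon_gx) 1 = axis (mon_g, mon_gx) 1 \<cdot>\<^bsub>alg2 H\<^esub> N4 a"
    by (simp_all add: N4_def H_def)
  have R_q: "R_q q \<cdot>\<^bsub>alg2 H\<^esub> axis (mon_x, mon_g) 1 = axis (mon_x, mon_1) 1 \<cdot>\<^bsub>alg2 H\<^esub> (R_q q :: 'k^_)"
    "R_q q \<cdot>\<^bsub>alg2 H\<^esub> axis (mon_g, mon_gx) 1 = axis (mon_1, mon_gx) 1 \<cdot>\<^bsub>alg2 H\<^esub> (R_q q :: 'k^_)"
  proof -
    note R_q_F4 = R_q_F4[OF two, folded H_def]
    consider "q = 0" | "q = Suc 0" using q by auto
    then have "R_q q \<cdot>\<^bsub>alg2 H\<^esub> axis (mon_x, mon_g) 1 = axis (mon_x, mon_1) 1 \<cdot>\<^bsub>alg2 H\<^esub> (R_q q :: 'k^_) \<and>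
        R_q q \<cdot>\<^bsub>alg2 H\<^esub> axis (mon_g, mon_gx) 1 = axis (mon_1, mon_gx) 1 \<cdot>\<^bsub>alg2 H\<^esub> (R_q q :: 'k^_)"
    proof cases
      case 1
      then show ?thesis by (simp only: R_q_F4 alg_mult_simps F4 simp_thms)
    next
      case 2
      have "?F mon_g mon_h \<cdot>\<^bsub>alg2 H\<^esub> ?F mon_h mon_gh \<cdot>\<^bsub>alg2 H\<^esub> axis (mon_x, mon_g) 1 =
          axis (mon_x, mon_1) 1 \<cdot>\<^bsub>alg2 H\<^esub> (?F mon_g mon_h \<cdot>\<^bsub>alg2 H\<^esub> ?F mon_h mon_gh)"
        "?F mon_g mon_h \<cdot>\<^bsub>alg2 H\<^esub> ?F mon_h mon_gh \<cdot>\<^bsub>alg2 H\<^esub> axis (mon_g, mon_gx) 1 =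
          axis (mon_1, mon_gx) 1 \<cdot>\<^bsub>alg2 H\<^esub> (?F mon_g mon_h \<cdot>\<^bsub>alg2 H\<^esub> ?F mon_h mon_gh)"
        by (metis F4(3,4) assoc, metis F4(5,6) assoc)
      with 2 show ?thesis by (simp only: R_q_F4 alg_mult_simps simp_thms)
    qed
    then show "R_q q \<cdot>\<^bsub>alg2 H\<^esub> axis (mon_x, mon_g) 1 = axis (mon_x, mon_1) 1 \<cdot>\<^bsub>alg2 H\<^esub> (R_q q :: 'k^_)"
      "R_q q \<cdot>\<^bsub>alg2 H\<^esub> axis (mon_g, mon_gx) 1 = axis (mon_1, mon_gx) 1 \<cdot>\<^bsub>alg2 H\<^esub> (R_q q :: 'k^_)"
      by blast+
  qed
  show "R_a q a \<cdot>\<^bsub>alg2 H\<^esub> axis (mon_x, mon_g) 1 = axis (mon_x, mon_1) 1 \<cdot>\<^bsub>alg2 H\<^esub> R_a q a"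
    unfolding R_a by (metis R_q(1) N4(1) assoc)
  show "R_a q a \<cdot>\<^bsub>alg2 H\<^esub> axis (mon_g, mon_gx) 1 = axis (mon_1, mon_gx) 1 \<cdot>\<^bsub>alg2 H\<^esub> R_a q a"
    unfolding R_a by (metis R_q(2) N4(2) assoc)
qed

theorem proposition4p3:
  fixes a :: "'k::field" and q :: nat and X :: "'k^(monom \<times> monom)"
  assumes "CHAR('k) \<noteq> 2" and "q \<in> {0, 1}"
  shows "infinitesimal_R_matrix A_C2C2 (R_a q a) X \<longleftrightarrow>
    (\<exists>\<alpha>. X = \<alpha> *s (gen_x \<otimes> (gen_x \<cdot>\<^bsub>A_C2C2\<^esub> gen_g)))"
proof -
  obtain S :: "'k^(monom \<times> monom)" where S: "is_inverse (alg2 A_C2C2) (R_a q a) S"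
    using R_a_quasitriangular[OF assms] unfolding quasitriangular_structure_def by blast
  have two: "(2 :: 'k) \<noteq> 0" using assms(1) by (rule field_two_neq_zero)
  \<comment> \<open>The sign reflects \<open>xg = -gx\<close>, as basis monomials carry
    \<open>x\<close> on the right.\<close>
  have xg: "c *s (gen_x \<otimes> (gen_x \<cdot>\<^bsub>A_C2C2\<^esub> gen_g)) = (- c) *s axis (mon_x, mon_gx) 1"
    for c :: 'k
    by (simp add: gen_x_def gen_g_def)
  show ?thesis
  proof
    assume "infinitesimal_R_matrix A_C2C2 (R_a q a) X"
    \<comment> \<open>The double negation fits the shape of \<open>xg\<close>, with the negated
      coefficient as \<alpha>.\<close>
    then have "X = (- (- X $ (mon_x, mon_gx))) *s axis (mon_x, mon_gx) 1"
      using infinitesimal_R_matrix_imp_multiple[OF two S] by simp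
    then show "\<exists>\<alpha>. X = \<alpha> *s (gen_x \<otimes> (gen_x \<cdot>\<^bsub>A_C2C2\<^esub> gen_g))"
      unfolding xg by blast
  next
    assume "\<exists>\<alpha>. X = \<alpha> *s (gen_x \<otimes> (gen_x \<cdot>\<^bsub>A_C2C2\<^esub> gen_g))"
    then show "infinitesimal_R_matrix A_C2C2 (R_a q a) X"
      using infinitesimal_R_matrix_multiple[OF S R_a_skew_comm[OF two assms(2)]]
      unfolding xg by blast
  qed
qed

end
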